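(* Let $V$ be a finite-dimensional complex linear space with $\dim V>1$, and let $G\subset \mathrm{GL}(V)$ be a compact connected irreducible group. Then for any $v\in V$ and every complex linear subspace $H\subset V$ of complex codimension $1$ there exists $g\in G$ such that $gv\in H$.
   Context: Irreducible means that $V$ has no proper nonzero $G$-invariant complex linear subspace. Linear spaces are finite dimensional. *)

theory Defs
  imports "HOL-Analysis.Analysis" "HOL-Algebra.Group"
begin

text \<open>
  A finite-dimensional complex linear space: a complex scalar multiplication on a type whose
  underlying real space is Euclidean.  The Euclidean structure only supplies the canonical
  topology of a finite-dimensional space; it is arbitrary (compatible with the real scalars
  only) and independent of the linear data used below.  Every finite-dimensional complex linear
  space of positive dimension carries such a structure, and all of them induce the same topology
  on endomorphisms.
\<close>

locale complex_linear_space = vector_space smul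
  for smul :: "complex \<Rightarrow> 'v::euclidean_space \<Rightarrow> 'v" +
  assumes smul_of_real: "smul (complex_of_real r) x = r *\<^sub>R x"

text \<open>
  The group of complex-linear automorphisms.  All real-linear endomorphisms are bounded here, so
  taking them from the type of bounded linear maps is no restriction; it provides the topology.
\<close>

definition GL :: "(complex \<Rightarrow> 'v::euclidean_space \<Rightarrow> 'v) \<Rightarrow> ('v \<Rightarrow>\<^sub>L 'v) monoid" where
  "GL smul =
    \<lparr>carrier = {g. Vector_Spaces.linear smul smul (blinfun_apply g) \<and> bij (blinfun_apply g)},
     mult = (o\<^sub>L), one = id_blinfun\<rparr>"

definition irreducible_on ::
    "(complex \<Rightarrow> 'v::euclidean_space \<Rightarrow> 'v) \<Rightarrow> ('v \<Rightarrow>\<^sub>L 'v) set \<Rightarrow> bool" where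
  "irreducible_on smul G \<longleftrightarrow>
    \<not> (\<exists>W. module.subspace smul W \<and> W \<noteq> {0} \<and> W \<noteq> UNIV \<and>
          (\<forall>g\<in>G. \<forall>w\<in>W. blinfun_apply g w \<in> W))"

lemma (in complex_linear_space) complex_linear_imp_bounded_linear:
  assumes "Vector_Spaces.linear smul smul f"
  shows "bounded_linear f"
proof -
  interpret f: Vector_Spaces.linear smul smul f by fact
  have "Real_Vector_Spaces.linear f"
    by (rule linearI) (simp_all add: f.add f.scale flip: smul_of_real)
  then show ?thesis by (rule linear_conv_bounded_linear[THEN iffD1])
qed

lemma (in complex_linear_space) group_GL: "group (GL smul)"
proof (rule groupI)
  fix g assume g: "g \<in> carrier (GL smul)"
  then have lin: "Vector_Spaces.linear smul smul (blinfun_apply g)"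
    and bij: "bij (blinfun_apply g)" by (auto simp: GL_def)
  interpret g: Vector_Spaces.linear smul smul "blinfun_apply g" by (rule lin)
  let ?h = "inv_into UNIV (blinfun_apply g)"
  have gh: "blinfun_apply g (?h x) = x" for x
    using bij by (simp add: bij_is_surj surj_f_inv_f)
  have hg: "?h (blinfun_apply g x) = x" for x
    using bij by (simp add: bij_is_inj)
  have "?h (x + y) = ?h x + ?h y" for x y
    by (metis g.add gh hg)
  moreover have "?h (smul c x) = smul c (?h x)" for c x
    by (metis g.scale gh hg)
  ultimately have hlin: "Vector_Spaces.linear smul smul ?h"
    by unfold_locales auto
  have ap: "blinfun_apply (Blinfun ?h) = ?h"
    by (rule bounded_linear_Blinfun_apply)
      (rule complex_linear_imp_bounded_linear[OF hlin])
  have "Blinfun ?h \<in> carrier (GL smul)"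
    using hlin bij by (simp add: GL_def ap bij_imp_bij_inv)
  moreover have "Blinfun ?h o\<^sub>L g = id_blinfun"
    by (rule blinfun_eqI) (simp add: ap hg)
  ultimately show "\<exists>h\<in>carrier (GL smul). h \<otimes>\<^bsub>GL smul\<^esub> g = \<one>\<^bsub>GL smul\<^esub>"
    by (auto simp: GL_def)
next
  fix g h assume "g \<in> carrier (GL smul)" "h \<in> carrier (GL smul)"
  then show "g \<otimes>\<^bsub>GL smul\<^esub> h \<in> carrier (GL smul)"
    using Vector_Spaces.linear_compose[of smul smul "blinfun_apply h" smul "blinfun_apply g"]
      bij_comp[of "blinfun_apply h" "blinfun_apply g"]
    by (simp add: GL_def blinfun_compose.rep_eq o_def)
next
  show "\<one>\<^bsub>GL smul\<^esub> \<in> carrier (GL smul)"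
    using linear_id bij_id by (simp add: GL_def id_def)
qed (auto simp: GL_def intro: blinfun_eqI)

end

theory Submission
  imports Defs "HOL-Computational_Algebra.Fundamental_Theorem_Algebra"
begin

text \<open>
  Let \<open>l\<close> be a functional with kernel \<open>H\<close> and suppose that \<open>f g = l (g v)\<close> has no zero on \<open>G\<close>. The
  contradiction comes from a maximum principle for the argument of \<open>f\<close>, which replaces the usual
  argument with eigenfunctions of the Laplacian and thereby avoids Lie theory: all that is used is
  the invariant mean of a compact group.

  The argument of \<open>f\<close> need not be a single-valued function, but the obstruction is a character:
  \<open>f = \<bar>f\<bar> C u exp (i b)\<close> with a constant \<open>C\<close>, a homomorphism \<open>u\<close> to the unit circle and a continuous
  real \<open>b\<close> (\<open>phase_factorization\<close>). As \<open>u\<close> is trivial on commutators, \<open>f (x s) / f x\<close> has the argument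
  \<open>b (x s) - b x\<close> whenever \<open>s\<close> is conjugate to a commutator.

  Since \<open>dim V > 1\<close>, the irreducible group \<open>G\<close> is not abelian, and as it is connected there is a
  commutator \<open>y \<noteq> 1\<close> as close to \<open>1\<close> as desired (\<open>small_commutator\<close>). By Schur's lemma the mean of the
  conjugates \<open>k y k\<^sup>-\<^sup>1\<close> over \<open>k\<close> is a scalar \<open>\<mu>\<close>, so \<open>\<mu> f x\<close> is the mean of \<open>f (x k y k\<^sup>-\<^sup>1)\<close>. Divide by \<open>f x\<close>
  and take imaginary parts: where \<open>b\<close> is maximal all arguments are in \<open>(-\<pi>, 0]\<close>, so \<open>Im \<mu> \<le> 0\<close>; where \<open>b\<close>
  is minimal, \<open>Im \<mu> \<ge> 0\<close>. Hence \<open>\<mu>\<close> is real and right translation by the conjugates of \<open>y\<close> preserves the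
  set where \<open>b\<close> is maximal. At a point of this set where \<open>\<bar>f\<bar>\<close> is minimal, the same mean value
  property shows \<open>\<mu> \<ge> 1\<close> (\<open>conj_mean_scalar_ge_1\<close>). But the conjugates of \<open>y\<close> are isometries for an
  invariant inner product, and their mean can be a scalar \<open>\<ge> 1\<close> only if \<open>y = 1\<close>
  (\<open>id_of_conj_mean_ge_1\<close>).
\<close>

section \<open>The invariant mean of a compact group\<close>

text \<open>
  A compact metrizable group carried by a subset. The associative law and the unit laws hold on the
  whole ambient type, as they do for the composition of linear maps; this lets the
  averaging operators below commute as operators on functions on the whole type.
\<close>

locale compact_group_on =
  fixes G :: "'a::metric_space set"
    and mul :: "'a \<Rightarrow> 'a \<Rightarrow> 'a" (infixl "\<cdot>" 70)
    and e :: 'a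
  assumes assoc: "(x \<cdot> y) \<cdot> z = x \<cdot> (y \<cdot> z)"
    and one_left [simp]: "e \<cdot> x = x"
    and one_right [simp]: "x \<cdot> e = x"
    and one_in [simp]: "e \<in> G"
    and mul_in [simp]: "x \<in> G \<Longrightarrow> y \<in> G \<Longrightarrow> x \<cdot> y \<in> G"
    and inverse_ex: "x \<in> G \<Longrightarrow> \<exists>y\<in>G. y \<cdot> x = e \<and> x \<cdot> y = e"
    and continuous_mul: "continuous_on (G \<times> G) (\<lambda>(x, y). x \<cdot> y)"
    and compact: "compact G"
begin

lemma opposite: "compact_group_on G (\<lambda>x y. y \<cdot> x) e"
proof
  have "continuous_on (G \<times> G) ((\<lambda>(x, y). x \<cdot> y) \<circ> prod.swap)"
    by (intro continuous_on_compose continuous_on_swap)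
       (simp add: product_swap continuous_mul)
  then show "continuous_on (G \<times> G) (\<lambda>(x, y). y \<cdot> x)"
    by (simp add: o_def case_prod_unfold)
qed (use inverse_ex in \<open>auto simp: assoc compact\<close>)

lemma continuous_on_mul [continuous_intros]:
  assumes "continuous_on S f" "continuous_on S g"
    and "\<And>x. x \<in> S \<Longrightarrow> f x \<in> G" "\<And>x. x \<in> S \<Longrightarrow> g x \<in> G"
  shows "continuous_on S (\<lambda>x. f x \<cdot> g x)"
proof -
  have "continuous_on S ((\<lambda>(x, y). x \<cdot> y) \<circ> (\<lambda>x. (f x, g x)))"
    by (intro continuous_on_compose continuous_intros assms
         continuous_on_subset[OF continuous_mul]) (use assms in auto)
  then show ?thesis by (simp add: o_def)
qed

lemma continuous_on_translate:
  fixes \<phi> :: "'a \<Rightarrow> 'b::topological_space"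
  assumes "continuous_on G \<phi>" "g \<in> G"
  shows "continuous_on G (\<lambda>x. \<phi> (g \<cdot> x))" "continuous_on G (\<lambda>x. \<phi> (x \<cdot> g))"
  by (rule continuous_on_compose2[OF assms(1)]; use assms(2) in \<open>auto intro!: continuous_intros\<close>)+

lemma uniformly_continuous_right:
  fixes \<phi> :: "'a \<Rightarrow> 'b::metric_space"
  assumes "continuous_on G \<phi>" "\<epsilon> > 0"
  obtains \<delta> where "\<delta> > 0"
    "\<And>x u. x \<in> G \<Longrightarrow> u \<in> G \<Longrightarrow> dist u e < \<delta> \<Longrightarrow> dist (\<phi> (x \<cdot> u)) (\<phi> x) < \<epsilon>"
proof -
  have "continuous_on (G \<times> G) (\<lambda>p. \<phi> (fst p \<cdot> snd p))"
    by (rule continuous_on_compose2[OF assms(1)]) (auto intro!: continuous_intros)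
  then have "uniformly_continuous_on (G \<times> G) (\<lambda>p. \<phi> (fst p \<cdot> snd p))"
    by (intro compact_uniformly_continuous compact_Times compact)
  then obtain \<delta> where \<delta>: "\<delta> > 0" and
    *: "\<And>p q. p \<in> G \<times> G \<Longrightarrow> q \<in> G \<times> G \<Longrightarrow> dist q p < \<delta> \<Longrightarrow>
      dist (\<phi> (fst q \<cdot> snd q)) (\<phi> (fst p \<cdot> snd p)) < \<epsilon>"
    using assms(2) unfolding uniformly_continuous_on_def by metis
  show ?thesis
  proof (rule that[OF \<delta>])
    fix x u assume "x \<in> G" "u \<in> G" "dist u e < \<delta>"
    then show "dist (\<phi> (x \<cdot> u)) (\<phi> x) < \<epsilon>"
      using *[of "(x, e)" "(x, u)"] by (simp add: dist_Pair_Pair)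
  qed
qed

text \<open>
  The operators that replace a function by a convex combination of its left translates. Closure under
  composition is built in, because the mean is found by averaging repeatedly.
\<close>

inductive_set averages :: "(('a \<Rightarrow> real) \<Rightarrow> 'a \<Rightarrow> real) set" where
  translate: "g \<in> G \<Longrightarrow> (\<lambda>\<phi> x. \<phi> (g \<cdot> x)) \<in> averages"
| compose: "A \<in> averages \<Longrightarrow> B \<in> averages \<Longrightarrow> (\<lambda>\<phi>. A (B \<phi>)) \<in> averages"
| mix: "A \<in> averages \<Longrightarrow> B \<in> averages \<Longrightarrow> 0 \<le> t \<Longrightarrow> t \<le> 1 \<Longrightarrow>
    (\<lambda>\<phi> x. t * A \<phi> x + (1 - t) * B \<phi> x) \<in> averages"

lemma average_linear:
  "A \<in> averages \<Longrightarrow> A (\<lambda>x. s * \<phi> x + t * \<psi> x) = (\<lambda>x. s * A \<phi> x + t * A \<psi> x)"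
proof (induction arbitrary: \<phi> \<psi> rule: averages.induct)
qed (auto simp: algebra_simps)

lemma average_diff: "A \<in> averages \<Longrightarrow> A (\<lambda>x. \<phi> x - \<psi> x) = (\<lambda>x. A \<phi> x - A \<psi> x)"
  using average_linear[of A 1 \<phi> "-1" \<psi>] by simp

lemma average_right_translate:
  "A \<in> averages \<Longrightarrow> A (\<lambda>x. \<phi> (x \<cdot> h)) = (\<lambda>x. A \<phi> (x \<cdot> h))"
proof (induction arbitrary: \<phi> rule: averages.induct)
qed (auto simp: assoc)

lemma average_bounds:
  "A \<in> averages \<Longrightarrow> (\<And>x. x \<in> G \<Longrightarrow> a \<le> \<phi> x \<and> \<phi> x \<le> b) \<Longrightarrow> x \<in> G \<Longrightarrow> a \<le> A \<phi> x \<and> A \<phi> x \<le> b"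
proof (induction arbitrary: \<phi> x rule: averages.induct)
  case (mix A B t)
  then have "a \<le> A \<phi> x" "A \<phi> x \<le> b" "a \<le> B \<phi> x" "B \<phi> x \<le> b" by auto
  then show ?case
    using convex_bound_le[of "A \<phi> x" b "B \<phi> x" t "1 - t"]
      convex_bound_le[of "- A \<phi> x" "- a" "- B \<phi> x" t "1 - t"] mix.hyps by auto
qed auto

lemma average_continuous:
  "A \<in> averages \<Longrightarrow> continuous_on G \<phi> \<Longrightarrow> continuous_on G (A \<phi>)"
proof (induction arbitrary: \<phi> rule: averages.induct)
qed (auto intro!: continuous_intros continuous_on_translate)

lemma average_of_finite:
  assumes "finite T" "T \<noteq> {}" "T \<subseteq> G"
  shows "(\<lambda>\<phi> x. (\<Sum>t\<in>T. \<phi> (t \<cdot> x)) / card T) \<in> averages"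
  using assms
proof (induction rule: finite_ne_induct)
  case (singleton g)
  then show ?case using translate[of g] by simp
next
  case (insert g T)
  define s where "s = 1 / real (card (insert g T))"
  have s: "0 \<le> s" "s \<le> 1" "card T > 0" using insert.hyps by (auto simp: s_def card_gt_0_iff)
  have "(\<lambda>\<phi> x. s * \<phi> (g \<cdot> x) + (1 - s) * ((\<Sum>t\<in>T. \<phi> (t \<cdot> x)) / card T)) \<in> averages"
    using insert s by (intro mix translate) auto
  also have "(\<lambda>\<phi> x. s * \<phi> (g \<cdot> x) + (1 - s) * ((\<Sum>t\<in>T. \<phi> (t \<cdot> x)) / card T)) =
      (\<lambda>\<phi> x. (\<Sum>t\<in>insert g T. \<phi> (t \<cdot> x)) / card (insert g T))"
  proof (intro ext)
    fix \<phi> :: "'a \<Rightarrow> real" and x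
    have "1 - s = card T * s" using insert.hyps by (simp add: s_def field_simps)
    then have "(1 - s) * ((\<Sum>t\<in>T. \<phi> (t \<cdot> x)) / card T) = s * (\<Sum>t\<in>T. \<phi> (t \<cdot> x))"
      using s(3) by simp
    then show "s * \<phi> (g \<cdot> x) + (1 - s) * ((\<Sum>t\<in>T. \<phi> (t \<cdot> x)) / card T) =
      (\<Sum>t\<in>insert g T. \<phi> (t \<cdot> x)) / card (insert g T)"
      using insert.hyps by (simp add: s_def add_divide_distrib)
  qed
  finally show ?case .
qed

text \<open>
  By compactness finitely many translates of a neighbourhood of the unit cover the group, and their
  number serves for all base points: a nonnegative function that is large near one point, no matter
  which, has an average that is bounded below by a fixed fraction of that size everywhere.
\<close>

lemma averages_spread:
  assumes "\<delta> > 0"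
  obtains c where "0 < c" "c \<le> 1"
    "\<And>x0. x0 \<in> G \<Longrightarrow> \<exists>A\<in>averages. \<forall>\<phi> \<epsilon>. (\<forall>x\<in>G. 0 \<le> \<phi> x) \<longrightarrow>
       (\<forall>u\<in>G. dist u e < \<delta> \<longrightarrow> \<epsilon> \<le> \<phi> (x0 \<cdot> u)) \<longrightarrow> (\<forall>x\<in>G. c * \<epsilon> \<le> A \<phi> x)"
proof -
  have op: "openin (top_of_set G) {x \<in> G. dist (h \<cdot> x) e < \<delta>}" if "h \<in> G" for h
  proof -
    have "continuous_on G (\<lambda>x. dist (h \<cdot> x) e)"
      using that by (auto intro!: continuous_intros)
    from continuous_openin_preimage_gen[OF this, of "{..<\<delta>}"]
    show ?thesis by (simp add: vimage_def Int_def)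
  qed
  have "G \<subseteq> \<Union> ((\<lambda>h. {x \<in> G. dist (h \<cdot> x) e < \<delta>}) ` G)"
  proof
    fix x assume "x \<in> G"
    then obtain h where "h \<in> G" "h \<cdot> x = e" using inverse_ex by blast
    then show "x \<in> \<Union> ((\<lambda>h. {x \<in> G. dist (h \<cdot> x) e < \<delta>}) ` G)"
      using \<open>x \<in> G\<close> assms by force
  qed
  then obtain D where D: "D \<subseteq> (\<lambda>h. {x \<in> G. dist (h \<cdot> x) e < \<delta>}) ` G" "finite D" "G \<subseteq> \<Union>D"
    using compact[unfolded compact_eq_openin_cover, rule_format,
        of "(\<lambda>h. {x \<in> G. dist (h \<cdot> x) e < \<delta>}) ` G"] op by blast
  then obtain T where T: "T \<subseteq> G" "finite T" "D = (\<lambda>h. {x \<in> G. dist (h \<cdot> x) e < \<delta>}) ` T"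
    by (meson finite_subset_image)
  have cov: "\<exists>h\<in>T. dist (h \<cdot> x) e < \<delta>" if "x \<in> G" for x using D T that by auto
  then have ne: "T \<noteq> {}" using one_in by blast
  define c where "c = 1 / real (card T)"
  have n: "card T > 0" using ne T by (simp add: card_gt_0_iff)
  show ?thesis
  proof (rule that[of c])
    show "0 < c" "c \<le> 1" using n by (auto simp: c_def)
    fix x0 assume x0: "x0 \<in> G"
    show "\<exists>A\<in>averages. \<forall>\<phi> \<epsilon>. (\<forall>x\<in>G. 0 \<le> \<phi> x) \<longrightarrow>
       (\<forall>u\<in>G. dist u e < \<delta> \<longrightarrow> \<epsilon> \<le> \<phi> (x0 \<cdot> u)) \<longrightarrow> (\<forall>x\<in>G. c * \<epsilon> \<le> A \<phi> x)"
    proof (rule bexI)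
      show "(\<lambda>\<phi> x. (\<Sum>h\<in>T. \<phi> (x0 \<cdot> (h \<cdot> x))) / card T) \<in> averages"
        using compose[OF average_of_finite[OF T(2) ne T(1)] translate[OF x0]] .
      show "\<forall>\<phi> \<epsilon>. (\<forall>x\<in>G. 0 \<le> \<phi> x) \<longrightarrow>
       (\<forall>u\<in>G. dist u e < \<delta> \<longrightarrow> \<epsilon> \<le> \<phi> (x0 \<cdot> u)) \<longrightarrow>
       (\<forall>x\<in>G. c * \<epsilon> \<le> (\<Sum>h\<in>T. \<phi> (x0 \<cdot> (h \<cdot> x))) / card T)"
      proof (intro allI impI ballI)
        fix \<phi> :: "'a \<Rightarrow> real" and \<epsilon> x
        assume \<phi>: "\<forall>x\<in>G. 0 \<le> \<phi> x" "\<forall>u\<in>G. dist u e < \<delta> \<longrightarrow> \<epsilon> \<le> \<phi> (x0 \<cdot> u)" and x: "x \<in> G"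
        obtain h where h: "h \<in> T" "dist (h \<cdot> x) e < \<delta>" using cov[OF x] by blast
        then have hG: "h \<in> G" using T by auto
        have "\<epsilon> \<le> \<phi> (x0 \<cdot> (h \<cdot> x))" using \<phi>(2) h hG x by simp
        also have "\<dots> \<le> (\<Sum>h\<in>T. \<phi> (x0 \<cdot> (h \<cdot> x)))"
          using h T x x0 \<phi>(1) by (intro member_le_sum) auto
        finally show "c * \<epsilon> \<le> (\<Sum>h\<in>T. \<phi> (x0 \<cdot> (h \<cdot> x))) / card T"
          using n by (simp add: c_def divide_right_mono)
      qed
    qed
  qed
qed

text \<open>
  All averages of \<open>\<phi>\<close> share its modulus of continuity with respect to right translation. So whenever an
  average still oscillates by \<open>L \<ge> \<epsilon>\<close>, it is large in a neighbourhood of fixed size, and one further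
  average raises its lower bound by a fixed amount; or else it stays below the middle of its range, and
  then the bound \<open>L\<close> can be halved at once.
\<close>

lemma small_oscillation_average:
  assumes \<phi>: "continuous_on G \<phi>" and "\<epsilon> > 0"
  obtains A a where "A \<in> averages" "\<And>x. x \<in> G \<Longrightarrow> a \<le> A \<phi> x \<and> A \<phi> x \<le> a + \<epsilon>"
proof -
  obtain \<delta> where "\<delta> > 0" and
    \<delta>: "\<And>x u. x \<in> G \<Longrightarrow> u \<in> G \<Longrightarrow> dist u e < \<delta> \<Longrightarrow> dist (\<phi> (x \<cdot> u)) (\<phi> x) < \<epsilon> / 4"
    using uniformly_continuous_right[OF \<phi>, of "\<epsilon> / 4"] \<open>\<epsilon> > 0\<close> by auto
  obtain c where c: "0 < c" "c \<le> 1" and spread: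
    "\<And>x0. x0 \<in> G \<Longrightarrow> \<exists>A\<in>averages. \<forall>\<phi> \<epsilon>. (\<forall>x\<in>G. 0 \<le> \<phi> x) \<longrightarrow>
       (\<forall>u\<in>G. dist u e < \<delta> \<longrightarrow> \<epsilon> \<le> \<phi> (x0 \<cdot> u)) \<longrightarrow> (\<forall>x\<in>G. c * \<epsilon> \<le> A \<phi> x)"
    using averages_spread[OF \<open>\<delta> > 0\<close>] by metis
  define small where
    "small L \<longleftrightarrow> (\<exists>A\<in>averages. \<exists>a. \<forall>x\<in>G. a \<le> A \<phi> x \<and> A \<phi> x \<le> a + L)" for L
  have mono: "small L'" if "small L" "L \<le> L'" for L L'
    using that unfolding small_def by (meson add_left_mono order_trans)
  have step: "small (L - c * (\<epsilon> / 4))" if "small L" "\<epsilon> \<le> L" for L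
  proof -
    obtain A a where A: "A \<in> averages" and Aa: "\<And>x. x \<in> G \<Longrightarrow> a \<le> A \<phi> x \<and> A \<phi> x \<le> a + L"
      using \<open>small L\<close> unfolding small_def by blast
    have cL: "c * (\<epsilon> / 4) \<le> L / 2"
      using c \<open>\<epsilon> > 0\<close> \<open>\<epsilon> \<le> L\<close> mult_right_mono[of c 1 "\<epsilon> / 4"] by linarith
    show ?thesis
    proof (cases "\<exists>x0\<in>G. a + L / 2 \<le> A \<phi> x0")
      case True
      then obtain x0 where x0: "x0 \<in> G" "a + L / 2 \<le> A \<phi> x0" by blast
      obtain B where B: "B \<in> averages" and BB: "\<And>\<phi> \<epsilon>. (\<forall>x\<in>G. 0 \<le> \<phi> x) \<Longrightarrow>
         (\<forall>u\<in>G. dist u e < \<delta> \<longrightarrow> \<epsilon> \<le> \<phi> (x0 \<cdot> u)) \<Longrightarrow> (\<forall>x\<in>G. c * \<epsilon> \<le> B \<phi> x)"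
        using spread[OF x0(1)] by blast
      have near: "a + \<epsilon> / 4 \<le> A \<phi> (x0 \<cdot> u)" if u: "u \<in> G" "dist u e < \<delta>" for u
      proof -
        have "\<bar>A (\<lambda>x. \<phi> (x \<cdot> u) - \<phi> x) x0\<bar> \<le> \<epsilon> / 4"
        proof -
          have "- (\<epsilon> / 4) \<le> \<phi> (x \<cdot> u) - \<phi> x \<and> \<phi> (x \<cdot> u) - \<phi> x \<le> \<epsilon> / 4" if "x \<in> G" for x
            using \<delta>[OF that u] unfolding dist_real_def by linarith
          from average_bounds[OF A, of "- (\<epsilon> / 4)" "\<lambda>x. \<phi> (x \<cdot> u) - \<phi> x", OF this x0(1)] show ?thesis by linarith
        qed
        then have "\<bar>A \<phi> (x0 \<cdot> u) - A \<phi> x0\<bar> \<le> \<epsilon> / 4"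
          by (simp add: average_diff[OF A] average_right_translate[OF A])
        then show ?thesis using x0 \<open>\<epsilon> \<le> L\<close> by linarith
      qed
      have "\<forall>x\<in>G. c * (\<epsilon> / 4) \<le> B (\<lambda>x. A \<phi> x - a) x"
        using near Aa by (intro BB) (auto simp: algebra_simps)
      moreover have "B (\<lambda>x. A \<phi> x - a) x = B (A \<phi>) x - a" if "x \<in> G" for x
      proof -
        have "B (\<lambda>x. a) x = a" using average_bounds[OF B, of a "\<lambda>x. a" a] that by force
        then show ?thesis by (simp only: average_diff[OF B])
      qed
      ultimately have "\<forall>x\<in>G. a + c * (\<epsilon> / 4) \<le> B (A \<phi>) x" by (simp add: algebra_simps)
      moreover have "\<forall>x\<in>G. B (A \<phi>) x \<le> a + L" using average_bounds[OF B, of a "A \<phi>" "a + L"] Aa by blast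
      ultimately show ?thesis unfolding small_def
        by (intro bexI[OF _ compose[OF B A]] exI[of _ "a + c * (\<epsilon> / 4)"]) auto
    next
      case False
      then have "small (L / 2)" unfolding small_def using Aa
        by (intro bexI[OF _ A] exI[of _ a]) (force simp: not_le)
      then show ?thesis by (rule mono) (use cL in linarith)
    qed
  qed
  have "bounded (\<phi> ` G)" by (intro compact_imp_bounded compact_continuous_image \<phi> compact)
  then obtain b where b: "\<And>x. x \<in> G \<Longrightarrow> \<bar>\<phi> x\<bar> \<le> b" by (auto simp: bounded_iff)
  have start: "small (2 * b)" unfolding small_def
    using b by (intro bexI[OF _ translate[OF one_in]] exI[of _ "- b"]) (force simp: abs_le_iff)
  have "small \<epsilon> \<or> small (2 * b - real n * (c * (\<epsilon> / 4)))" for n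
  proof (induction n)
    case (Suc n)
    show ?case
    proof (cases "small \<epsilon>")
      case False
      then have *: "small (2 * b - real n * (c * (\<epsilon> / 4)))" using Suc by simp
      then have "\<epsilon> \<le> 2 * b - real n * (c * (\<epsilon> / 4))" using mono[OF *, of \<epsilon>] False by linarith
      from step[OF * this] show ?thesis by (simp add: algebra_simps add_divide_distrib)
    qed simp
  qed (simp add: start)
  moreover obtain n where "2 * b < real n * (c * (\<epsilon> / 4))"
    using reals_Archimedean3[of "c * (\<epsilon> / 4)"] c \<open>\<epsilon> > 0\<close> by (metis mult_pos_pos zero_less_divide_iff zero_less_numeral)
  then have "2 * b - real n * (c * (\<epsilon> / 4)) \<le> \<epsilon>" using \<open>\<epsilon> > 0\<close> by linarith
  ultimately have "small \<epsilon>" using mono by metis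
  then obtain A a where "A \<in> averages" "\<forall>x\<in>G. a \<le> A \<phi> x \<and> A \<phi> x \<le> a + \<epsilon>"
    unfolding small_def by blast
  then show ?thesis using that[of A a] by simp
qed

definition approx_mean :: "('a \<Rightarrow> real) \<Rightarrow> real \<Rightarrow> bool" where
  "approx_mean \<phi> m \<longleftrightarrow> (\<forall>\<epsilon>>0. \<exists>A\<in>averages. \<forall>x\<in>G. \<bar>A \<phi> x - m\<bar> \<le> \<epsilon>)"

text \<open>
  Averages of small oscillation are close to constants; the mean is a limit point of these constants.
\<close>

lemma approx_mean_exists:
  assumes \<phi>: "continuous_on G \<phi>"
  obtains m where "approx_mean \<phi> m"
proof -
  have "\<exists>A a. A \<in> averages \<and> (\<forall>x\<in>G. \<bar>A \<phi> x - a\<bar> \<le> inverse (real (Suc n)))" for n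
  proof -
    obtain A a where "A \<in> averages"
      "\<And>x. x \<in> G \<Longrightarrow> a \<le> A \<phi> x \<and> A \<phi> x \<le> a + inverse (real (Suc n))"
      using small_oscillation_average[OF \<phi>, of "inverse (real (Suc n))"] by auto
    then show ?thesis
      by (intro exI[of _ A] exI[of _ a]) (smt (verit, best))
  qed
  then obtain A a where A: "\<And>n. A n \<in> averages"
    and a: "\<And>n x. x \<in> G \<Longrightarrow> \<bar>A n \<phi> x - a n\<bar> \<le> inverse (real (Suc n))"
    by metis
  have "bounded (\<phi> ` G)" by (intro compact_imp_bounded compact_continuous_image \<phi> compact)
  then obtain b where b: "\<And>x. x \<in> G \<Longrightarrow> \<bar>\<phi> x\<bar> \<le> b" by (auto simp: bounded_iff)
  have "\<bar>a n\<bar> \<le> b + 1" for n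
  proof -
    have "- b \<le> A n \<phi> e \<and> A n \<phi> e \<le> b"
      by (rule average_bounds[OF A _ one_in]) (use b in \<open>simp add: abs_le_iff minus_le_iff\<close>)
    moreover have "inverse (real (Suc n)) \<le> 1" by (simp add: field_simps)
    ultimately show ?thesis using a[OF one_in, of n] by linarith
  qed
  then have "bounded (range a)" by (auto simp: bounded_iff)
  then obtain m r where r: "strict_mono r" "(a \<circ> r) \<longlonglongrightarrow> m"
    using bounded_imp_convergent_subsequence by blast
  have "approx_mean \<phi> m" unfolding approx_mean_def
  proof (intro allI impI)
    fix \<epsilon> :: real assume "\<epsilon> > 0"
    have "(\<lambda>n. inverse (real (Suc (r n)))) \<longlonglongrightarrow> 0"
      using LIMSEQ_subseq_LIMSEQ[OF LIMSEQ_inverse_real_of_nat r(1)] by (simp add: o_def)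
    then have "\<forall>\<^sub>F n in sequentially. inverse (real (Suc (r n))) < \<epsilon> / 2"
      by (rule order_tendstoD) (use \<open>\<epsilon> > 0\<close> in simp)
    moreover have "\<forall>\<^sub>F n in sequentially. dist ((a \<circ> r) n) m < \<epsilon> / 2"
      by (rule tendstoD[OF r(2)]) (use \<open>\<epsilon> > 0\<close> in simp)
    ultimately have "\<forall>\<^sub>F n in sequentially. inverse (real (Suc (r n))) < \<epsilon> / 2 \<and> dist (a (r n)) m < \<epsilon> / 2"
      by eventually_elim simp
    then obtain n where n: "inverse (real (Suc (r n))) < \<epsilon> / 2" "dist (a (r n)) m < \<epsilon> / 2"
      by (auto simp: eventually_sequentially)
    show "\<exists>A\<in>averages. \<forall>x\<in>G. \<bar>A \<phi> x - m\<bar> \<le> \<epsilon>"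
    proof (intro bexI[OF _ A] ballI)
      fix x assume "x \<in> G"
      from a[OF this, of "r n"] n show "\<bar>A (r n) \<phi> x - m\<bar> \<le> \<epsilon>"
        unfolding dist_real_def by linarith
    qed
  qed
  then show ?thesis by (rule that)
qed

abbreviation right_averages where
  "right_averages \<equiv> compact_group_on.averages G (\<lambda>x y. y \<cdot> x)"

abbreviation approx_right_mean where
  "approx_right_mean \<equiv> compact_group_on.approx_mean G (\<lambda>x y. y \<cdot> x)"

text \<open>
  Right averages are the left averages of the opposite group. Because they commute with left averages,
  the constants that are approximated from the left and from the right have to agree, which is what
  makes the mean unique.
\<close>

lemma left_right_averages_commute:
  assumes "A \<in> averages" and B: "B \<in> right_averages"
  shows "A (B \<phi>) = B (A \<phi>)"
proof -
  interpret op: compact_group_on G "\<lambda>x y. y \<cdot> x" e by (rule opposite)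
  show ?thesis using assms(1)
  proof (induction arbitrary: \<phi> rule: averages.induct)
    case (translate g)
    show ?case using op.average_right_translate[OF B, of \<phi> g] by (simp add: fun_eq_iff)
  next
    case (mix A1 A2 t)
    then show ?case by (simp add: op.average_linear[OF B])
  qed simp
qed

lemma approx_mean_unique:
  assumes a: "approx_mean \<phi> a" and b: "approx_right_mean \<phi> b"
  shows "a = b"
proof -
  interpret op: compact_group_on G "\<lambda>x y. y \<cdot> x" e by (rule opposite)
  have "\<bar>a - b\<bar> \<le> 0 + \<epsilon>" if "\<epsilon> > 0" for \<epsilon>
  proof -
    obtain A where A: "A \<in> averages" "\<And>x. x \<in> G \<Longrightarrow> \<bar>A \<phi> x - a\<bar> \<le> \<epsilon> / 2"
      using a[unfolded approx_mean_def, rule_format, of "\<epsilon> / 2"] \<open>\<epsilon> > 0\<close> by auto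
    obtain B where B: "B \<in> right_averages" "\<And>x. x \<in> G \<Longrightarrow> \<bar>B \<phi> x - b\<bar> \<le> \<epsilon> / 2"
      using b[unfolded op.approx_mean_def, rule_format, of "\<epsilon> / 2"] \<open>\<epsilon> > 0\<close> by auto
    have "a - \<epsilon> / 2 \<le> A \<phi> x \<and> A \<phi> x \<le> a + \<epsilon> / 2" if "x \<in> G" for x
      using A(2)[OF that] by linarith
    then have "a - \<epsilon> / 2 \<le> B (A \<phi>) e \<and> B (A \<phi>) e \<le> a + \<epsilon> / 2"
      by (intro op.average_bounds[OF B(1)]) auto
    moreover have "b - \<epsilon> / 2 \<le> B \<phi> x \<and> B \<phi> x \<le> b + \<epsilon> / 2" if "x \<in> G" for x
      using B(2)[OF that] by linarith
    then have "b - \<epsilon> / 2 \<le> A (B \<phi>) e \<and> A (B \<phi>) e \<le> b + \<epsilon> / 2"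
      by (intro average_bounds[OF A(1)]) auto
    ultimately show ?thesis
      unfolding left_right_averages_commute[OF A(1) B(1)] by linarith
  qed
  then have "\<bar>a - b\<bar> \<le> 0" by (rule field_le_epsilon)
  then show ?thesis by simp
qed

definition mean :: "('a \<Rightarrow> real) \<Rightarrow> real" where
  "mean \<phi> = (THE m. approx_mean \<phi> m)"

lemma
  assumes "continuous_on G \<phi>"
  shows approx_mean_mean: "approx_mean \<phi> (mean \<phi>)"
    and approx_right_mean_mean: "approx_right_mean \<phi> (mean \<phi>)"
    and mean_eqI: "approx_mean \<phi> m \<Longrightarrow> mean \<phi> = m"
    and mean_eqI_right: "approx_right_mean \<phi> m \<Longrightarrow> mean \<phi> = m"
proof -
  interpret op: compact_group_on G "\<lambda>x y. y \<cdot> x" e by (rule opposite)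
  obtain a where a: "approx_mean \<phi> a" using approx_mean_exists[OF assms] .
  obtain b where b: "approx_right_mean \<phi> b" using op.approx_mean_exists[OF assms] .
  have eq: "mean \<phi> = b" unfolding mean_def
    by (rule the_equality) (use a b approx_mean_unique in metis)+
  then show "approx_mean \<phi> (mean \<phi>)" "approx_right_mean \<phi> (mean \<phi>)"
    "approx_mean \<phi> m \<Longrightarrow> mean \<phi> = m" "approx_right_mean \<phi> m \<Longrightarrow> mean \<phi> = m"
    using a b approx_mean_unique by metis+
qed

text \<open>
  The right averages that approximate the mean of \<open>\<phi>\<close> also approximate that of \<open>A \<phi>\<close>, since they commute with
  \<open>A\<close>.
\<close>

lemma mean_average:
  assumes \<phi>: "continuous_on G \<phi>" and A: "A \<in> averages"
  shows "mean (A \<phi>) = mean \<phi>"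
proof (rule mean_eqI_right[OF average_continuous[OF A \<phi>]])
  interpret op: compact_group_on G "\<lambda>x y. y \<cdot> x" e by (rule opposite)
  show "approx_right_mean (A \<phi>) (mean \<phi>)" unfolding op.approx_mean_def
  proof (intro allI impI)
    fix \<epsilon> :: real assume "\<epsilon> > 0"
    then obtain B where B: "B \<in> right_averages" "\<And>x. x \<in> G \<Longrightarrow> \<bar>B \<phi> x - mean \<phi>\<bar> \<le> \<epsilon>"
      using approx_right_mean_mean[OF \<phi>] unfolding op.approx_mean_def by metis
    show "\<exists>B\<in>right_averages. \<forall>x\<in>G. \<bar>B (A \<phi>) x - mean \<phi>\<bar> \<le> \<epsilon>"
    proof (intro bexI[OF _ B(1)] ballI)
      fix x assume "x \<in> G"
      have "mean \<phi> - \<epsilon> \<le> B \<phi> x \<and> B \<phi> x \<le> mean \<phi> + \<epsilon>" if "x \<in> G" for x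
        using B(2)[OF that] by linarith
      then have "mean \<phi> - \<epsilon> \<le> A (B \<phi>) x \<and> A (B \<phi>) x \<le> mean \<phi> + \<epsilon>"
        by (intro average_bounds[OF A]) (auto simp: \<open>x \<in> G\<close>)
      then show "\<bar>B (A \<phi>) x - mean \<phi>\<bar> \<le> \<epsilon>"
        unfolding left_right_averages_commute[OF A B(1)] by linarith
    qed
  qed
qed

lemma mean_translate:
  "continuous_on G \<phi> \<Longrightarrow> g \<in> G \<Longrightarrow> mean (\<lambda>x. \<phi> (g \<cdot> x)) = mean \<phi>"
  using mean_average[OF _ averages.translate] .

text \<open>
  One average that flattens both functions: the second operator flattens \<open>A \<psi>\<close>, which has the same mean as
  \<open>\<psi>\<close>, and leaves the already flat \<open>A \<phi>\<close> flat.
\<close>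

lemma mean_linear:
  assumes \<phi>: "continuous_on G \<phi>" and \<psi>: "continuous_on G \<psi>"
  shows "mean (\<lambda>x. s * \<phi> x + t * \<psi> x) = s * mean \<phi> + t * mean \<psi>"
proof (rule mean_eqI)
  show "continuous_on G (\<lambda>x. s * \<phi> x + t * \<psi> x)" by (intro continuous_intros \<phi> \<psi>)
  show "approx_mean (\<lambda>x. s * \<phi> x + t * \<psi> x) (s * mean \<phi> + t * mean \<psi>)"
    unfolding approx_mean_def
  proof (intro allI impI)
    fix \<epsilon> :: real assume "\<epsilon> > 0"
    define \<eta> where "\<eta> = \<epsilon> / (\<bar>s\<bar> + \<bar>t\<bar> + 1)"
    have \<eta>: "\<eta> > 0" "\<bar>s\<bar> * \<eta> + \<bar>t\<bar> * \<eta> \<le> \<epsilon>"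
      using \<open>\<epsilon> > 0\<close> by (auto simp: \<eta>_def field_simps add_pos_nonneg)
    obtain A where A: "A \<in> averages" "\<And>x. x \<in> G \<Longrightarrow> \<bar>A \<phi> x - mean \<phi>\<bar> \<le> \<eta>"
      using approx_mean_mean[OF \<phi>] \<eta>(1) unfolding approx_mean_def by metis
    obtain B where B: "B \<in> averages" "\<And>x. x \<in> G \<Longrightarrow> \<bar>B (A \<psi>) x - mean \<psi>\<bar> \<le> \<eta>"
      using approx_mean_mean[OF average_continuous[OF A(1) \<psi>]] \<eta>(1)
      unfolding approx_mean_def mean_average[OF \<psi> A(1)] by metis
    show "\<exists>C\<in>averages. \<forall>x\<in>G. \<bar>C (\<lambda>x. s * \<phi> x + t * \<psi> x) x - (s * mean \<phi> + t * mean \<psi>)\<bar> \<le> \<epsilon>"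
    proof (intro bexI[OF _ compose[OF B(1) A(1)]] ballI)
      fix x assume x: "x \<in> G"
      have "mean \<phi> - \<eta> \<le> A \<phi> x \<and> A \<phi> x \<le> mean \<phi> + \<eta>" if "x \<in> G" for x
        using A(2)[OF that] by linarith
      then have "mean \<phi> - \<eta> \<le> B (A \<phi>) x \<and> B (A \<phi>) x \<le> mean \<phi> + \<eta>"
        by (intro average_bounds[OF B(1)]) (auto simp: x)
      then have "\<bar>B (A \<phi>) x - mean \<phi>\<bar> \<le> \<eta>" by linarith
      then have "\<bar>s * (B (A \<phi>) x - mean \<phi>)\<bar> \<le> \<bar>s\<bar> * \<eta>"
        by (simp add: abs_mult mult_left_mono)
      moreover have "\<bar>t * (B (A \<psi>) x - mean \<psi>)\<bar> \<le> \<bar>t\<bar> * \<eta>"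
        using B(2)[OF x] by (simp add: abs_mult mult_left_mono)
      ultimately have "\<bar>s * (B (A \<phi>) x - mean \<phi>) + t * (B (A \<psi>) x - mean \<psi>)\<bar> \<le> \<epsilon>"
        using \<eta>(2) by linarith
      then show "\<bar>B (A (\<lambda>x. s * \<phi> x + t * \<psi> x)) x - (s * mean \<phi> + t * mean \<psi>)\<bar> \<le> \<epsilon>"
        unfolding average_linear[OF A(1)] average_linear[OF B(1)] by (simp add: algebra_simps)
    qed
  qed
qed

lemma mean_bounds:
  assumes \<phi>: "continuous_on G \<phi>" and ab: "\<And>x. x \<in> G \<Longrightarrow> a \<le> \<phi> x \<and> \<phi> x \<le> b"
  shows "a \<le> mean \<phi> \<and> mean \<phi> \<le> b"
proof -
  have "a \<le> mean \<phi> + \<epsilon> \<and> mean \<phi> \<le> b + \<epsilon>" if "\<epsilon> > 0" for \<epsilon>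
  proof -
    obtain A where A: "A \<in> averages" "\<And>x. x \<in> G \<Longrightarrow> \<bar>A \<phi> x - mean \<phi>\<bar> \<le> \<epsilon>"
      using approx_mean_mean[OF \<phi>] \<open>\<epsilon> > 0\<close> unfolding approx_mean_def by metis
    moreover have "a \<le> A \<phi> e \<and> A \<phi> e \<le> b"
      by (intro average_bounds[OF A(1)] ab one_in)
    ultimately show ?thesis using A(2)[OF one_in] by linarith
  qed
  then show ?thesis by (meson field_le_epsilon)
qed

lemma mean_cong:
  assumes "continuous_on G \<phi>" "\<And>x. x \<in> G \<Longrightarrow> \<phi> x = \<psi> x"
  shows "mean \<phi> = mean \<psi>"
proof -
  have \<psi>: "continuous_on G \<psi>" using assms by (simp cong: continuous_on_cong)
  have c: "continuous_on G (\<lambda>x. \<phi> x - \<psi> x)" by (intro continuous_intros assms \<psi>)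
  have "0 \<le> mean (\<lambda>x. \<phi> x - \<psi> x) \<and> mean (\<lambda>x. \<phi> x - \<psi> x) \<le> 0"
    by (rule mean_bounds[OF c]) (simp add: assms)
  then show ?thesis using mean_linear[OF assms(1) \<psi>, of 1 "-1"] by simp
qed

lemma mean_const [simp]: "mean (\<lambda>x. c) = c"
  using mean_bounds[of "\<lambda>x. c" c c] by (simp add: continuous_on_const)

lemma mean_add: "continuous_on G \<phi> \<Longrightarrow> continuous_on G \<psi> \<Longrightarrow>
    mean (\<lambda>x. \<phi> x + \<psi> x) = mean \<phi> + mean \<psi>"
  using mean_linear[of \<phi> \<psi> 1 1] by simp

lemma mean_diff: "continuous_on G \<phi> \<Longrightarrow> continuous_on G \<psi> \<Longrightarrow>
    mean (\<lambda>x. \<phi> x - \<psi> x) = mean \<phi> - mean \<psi>"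
  using mean_linear[of \<phi> \<psi> 1 "-1"] by simp

lemma mean_mult_right: "continuous_on G \<phi> \<Longrightarrow> mean (\<lambda>x. \<phi> x * c) = mean \<phi> * c"
  using mean_linear[of \<phi> \<phi> c 0] by (simp add: mult.commute)

lemma mean_sum:
  assumes "\<And>i. i \<in> I \<Longrightarrow> continuous_on G (\<phi> i)"
  shows "mean (\<lambda>x. \<Sum>i\<in>I. \<phi> i x) = (\<Sum>i\<in>I. mean (\<phi> i))"
  using assms
proof (induction I rule: infinite_finite_induct)
  case (insert i I)
  then show ?case by (simp add: mean_add continuous_on_sum)
qed simp_all

lemma mean_mono:
  assumes "continuous_on G \<phi>" "continuous_on G \<psi>" and le: "\<And>x. x \<in> G \<Longrightarrow> \<phi> x \<le> \<psi> x"
  shows "mean \<phi> \<le> mean \<psi>"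
proof -
  have c: "continuous_on G (\<lambda>x. \<psi> x - \<phi> x)" by (intro continuous_intros assms)
  have "bounded ((\<lambda>x. \<psi> x - \<phi> x) ` G)"
    by (intro compact_imp_bounded compact_continuous_image c compact)
  then obtain b where b: "\<And>x. x \<in> G \<Longrightarrow> \<bar>\<psi> x - \<phi> x\<bar> \<le> b" by (auto simp: bounded_iff)
  have "0 \<le> mean (\<lambda>x. \<psi> x - \<phi> x)"
    using mean_bounds[OF c, of 0 b] b le by (force simp: abs_le_iff)
  then show ?thesis by (simp add: mean_diff assms)
qed

text \<open>
  The mean is strictly positive: a nonnegative function that does not vanish has an average bounded away
  from \<open>0\<close>, and averaging does not change the mean.
\<close>

lemma mean_eq_0:
  assumes \<phi>: "continuous_on G \<phi>" and nonneg: "\<And>x. x \<in> G \<Longrightarrow> 0 \<le> \<phi> x"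
    and "mean \<phi> \<le> 0" and x0: "x0 \<in> G"
  shows "\<phi> x0 = 0"
proof (rule ccontr)
  assume "\<phi> x0 \<noteq> 0"
  define \<epsilon> where "\<epsilon> = \<phi> x0 / 2"
  have \<epsilon>: "\<epsilon> > 0" using nonneg[OF x0] \<open>\<phi> x0 \<noteq> 0\<close> by (simp add: \<epsilon>_def)
  obtain \<delta> where "\<delta> > 0" and
    \<delta>: "\<And>x u. x \<in> G \<Longrightarrow> u \<in> G \<Longrightarrow> dist u e < \<delta> \<Longrightarrow> dist (\<phi> (x \<cdot> u)) (\<phi> x) < \<epsilon>"
    using uniformly_continuous_right[OF \<phi> \<epsilon>] by blast
  obtain c where c: "0 < c" and "\<exists>A\<in>averages. \<forall>\<phi> \<epsilon>. (\<forall>x\<in>G. 0 \<le> \<phi> x) \<longrightarrow>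
       (\<forall>u\<in>G. dist u e < \<delta> \<longrightarrow> \<epsilon> \<le> \<phi> (x0 \<cdot> u)) \<longrightarrow> (\<forall>x\<in>G. c * \<epsilon> \<le> A \<phi> x)"
    using averages_spread[OF \<open>\<delta> > 0\<close>] x0 by metis
  then obtain A where A: "A \<in> averages" "(\<forall>x\<in>G. 0 \<le> \<phi> x) \<Longrightarrow>
       (\<forall>u\<in>G. dist u e < \<delta> \<longrightarrow> \<epsilon> \<le> \<phi> (x0 \<cdot> u)) \<Longrightarrow> (\<forall>x\<in>G. c * \<epsilon> \<le> A \<phi> x)"
    by metis
  have "\<epsilon> \<le> \<phi> (x0 \<cdot> u)" if "u \<in> G" "dist u e < \<delta>" for u
    using \<delta>[OF x0 that] unfolding dist_real_def \<epsilon>_def by linarith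
  then have lower: "\<forall>x\<in>G. c * \<epsilon> \<le> A \<phi> x" using nonneg by (intro A(2)) auto
  have cA: "continuous_on G (A \<phi>)" by (rule average_continuous[OF A(1) \<phi>])
  have "bounded (A \<phi> ` G)" by (intro compact_imp_bounded compact_continuous_image cA compact)
  then obtain b where b: "\<And>x. x \<in> G \<Longrightarrow> \<bar>A \<phi> x\<bar> \<le> b" by (auto simp: bounded_iff)
  have "c * \<epsilon> \<le> mean (A \<phi>)"
    using mean_bounds[OF cA, of "c * \<epsilon>" b] lower b by (force simp: abs_le_iff)
  then show False
    using mean_average[OF \<phi> A(1)] \<open>mean \<phi> \<le> 0\<close> mult_pos_pos[OF c \<epsilon>] by linarith
qed

definition vmean :: "('a \<Rightarrow> 'b::euclidean_space) \<Rightarrow> 'b" where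
  "vmean F = (\<Sum>b\<in>Basis. mean (\<lambda>x. F x \<bullet> b) *\<^sub>R b)"

text \<open>
  This characterizes the vector-valued mean, whose definition by coordinates depends on the basis only
  apparently.
\<close>

lemma mean_linear_functional:
  fixes F :: "'a \<Rightarrow> 'b::euclidean_space" and l :: "'b \<Rightarrow> real"
  assumes F: "continuous_on G F" and l: "linear l"
  shows "mean (\<lambda>x. l (F x)) = l (vmean F)"
proof -
  have exp: "l v = (\<Sum>b\<in>Basis. (v \<bullet> b) * l b)" for v
    using linear_sum[OF l, of "\<lambda>b. (v \<bullet> b) *\<^sub>R b" Basis]
    by (simp add: euclidean_representation linear_cmul[OF l])
  have "mean (\<lambda>x. l (F x)) = (\<Sum>b\<in>Basis. mean (\<lambda>x. (F x \<bullet> b) * l b))"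
    unfolding exp[of "F _"] by (intro mean_sum continuous_intros F)
  also have "\<dots> = (\<Sum>b\<in>Basis. mean (\<lambda>x. F x \<bullet> b) * l b)"
    by (intro sum.cong refl mean_mult_right continuous_intros F)
  also have "\<dots> = l (vmean F)"
    unfolding vmean_def linear_sum[OF l] by (simp add: linear_cmul[OF l])
  finally show ?thesis .
qed

lemma vmean_linear_image:
  fixes F :: "'a \<Rightarrow> 'b::euclidean_space" and T :: "'b \<Rightarrow> 'c::euclidean_space"
  assumes F: "continuous_on G F" and T: "linear T"
  shows "vmean (\<lambda>x. T (F x)) = T (vmean F)"
proof (rule euclidean_eqI)
  fix b :: 'c assume "b \<in> Basis"
  have l: "linear (\<lambda>v. T v \<bullet> b)"
    using T by (auto simp: linear_iff inner_add_left)
  have "vmean (\<lambda>x. T (F x)) \<bullet> b = mean (\<lambda>x. T (F x) \<bullet> b)"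
    using \<open>b \<in> Basis\<close> by (simp add: vmean_def)
  then show "vmean (\<lambda>x. T (F x)) \<bullet> b = T (vmean F) \<bullet> b"
    using mean_linear_functional[OF F l] by simp
qed

lemma vmean_inner:
  fixes F :: "'a \<Rightarrow> 'b::euclidean_space"
  assumes "b \<in> Basis"
  shows "vmean F \<bullet> b = mean (\<lambda>x. F x \<bullet> b)"
  using assms by (simp add: vmean_def)

lemma vmean_cong:
  fixes F F' :: "'a \<Rightarrow> 'b::euclidean_space"
  assumes "continuous_on G F" "\<And>x. x \<in> G \<Longrightarrow> F x = F' x"
  shows "vmean F = vmean F'"
  unfolding vmean_def by (intro sum.cong refl arg_cong2[of _ _ _ _ "(*\<^sub>R)"] mean_cong
      continuous_intros assms) (simp add: assms)

lemma vmean_add: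
  fixes F F' :: "'a \<Rightarrow> 'b::euclidean_space"
  assumes "continuous_on G F" "continuous_on G F'"
  shows "vmean (\<lambda>x. F x + F' x) = vmean F + vmean F'"
  by (rule euclidean_eqI)
     (simp add: vmean_inner inner_add_left mean_add continuous_intros assms)

lemma vmean_translate:
  fixes F :: "'a \<Rightarrow> 'b::euclidean_space"
  assumes F: "continuous_on G F" and "g \<in> G"
  shows "vmean (\<lambda>x. F (g \<cdot> x)) = vmean F"
  unfolding vmean_def
  by (intro sum.cong refl arg_cong2[of _ _ _ _ "(*\<^sub>R)"]
      mean_translate[of "\<lambda>x. F x \<bullet> _"] continuous_intros assms)

end

section \<open>The phase of a nowhere vanishing function on a compact connected group\<close>

lemma continuous_logarithms_differ_by_constant:
  fixes L L' :: "'a::topological_space \<Rightarrow> complex"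
  assumes "connected S" "continuous_on S L" "continuous_on S L'"
    and eq: "\<And>z. z \<in> S \<Longrightarrow> exp (L z) = exp (L' z)"
  obtains n :: int where "\<And>z. z \<in> S \<Longrightarrow> L z = L' z + of_int (2 * n) * pi * \<i>"
proof (cases "S = {}")
  case False
  then obtain a where a: "a \<in> S" by blast
  have ex: "\<exists>n::int. L z = L' z + of_int (2 * n) * pi * \<i>" if "z \<in> S" for z
    using eq[OF that] by (simp add: exp_eq)
  have "(\<lambda>z. L z - L' z) constant_on S"
  proof (rule continuous_discrete_range_constant[OF assms(1)])
    show "continuous_on S (\<lambda>z. L z - L' z)" by (intro continuous_intros assms)
    fix x assume x: "x \<in> S"
    show "\<exists>\<epsilon>>0. \<forall>y. y \<in> S \<and> L y - L' y \<noteq> L x - L' x \<longrightarrow> \<epsilon> \<le> cmod (L y - L' y - (L x - L' x))"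
    proof (intro exI[of _ "2 * pi"] conjI allI impI)
      fix y assume y: "y \<in> S \<and> L y - L' y \<noteq> L x - L' x"
      obtain m n :: int where m: "L x = L' x + of_int (2 * m) * pi * \<i>"
        and n: "L y = L' y + of_int (2 * n) * pi * \<i>"
        using ex x y by metis
      have "L y - L' y - (L x - L' x) = of_real (2 * pi * of_int (n - m)) * \<i>"
        unfolding m n by (simp add: algebra_simps)
      then have *: "cmod (L y - L' y - (L x - L' x)) = 2 * pi * of_int \<bar>n - m\<bar>"
        by (simp only: norm_mult norm_of_real norm_ii) (simp add: abs_mult)
      have "n \<noteq> m" using y m n by auto
      then have "1 \<le> \<bar>n - m\<bar>" by linarith
      then have "(1::real) \<le> of_int \<bar>n - m\<bar>" by linarith
      then show "2 * pi \<le> cmod (L y - L' y - (L x - L' x))"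
        unfolding * by simp
    qed simp
  qed
  then obtain c where c: "\<And>z. z \<in> S \<Longrightarrow> L z - L' z = c" by (auto simp: constant_on_def)
  obtain n :: int where "L a = L' a + of_int (2 * n) * pi * \<i>" using ex[OF a] by blast
  with c[OF a] have "c = of_int (2 * n) * pi * \<i>" by simp
  then show ?thesis using c that[of n] by (metis add.commute diff_eq_eq)
qed (use that in simp)

lemma continuous_on_Ln_near_1:
  assumes q: "continuous_on S q" and near: "\<And>z. z \<in> S \<Longrightarrow> cmod (q z - 1) < 1"
  shows "continuous_on S (\<lambda>z. Ln (q z))"
proof (rule continuous_on_Ln'[OF q])
  fix z assume "z \<in> S"
  then have "0 < Re (q z)"
    using near abs_Re_le_cmod[of "q z - 1"] unfolding minus_complex.sel one_complex.sel by fastforce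
  then show "q z \<notin> \<real>\<^sub>\<le>\<^sub>0" by (simp add: complex_nonpos_Reals_iff)
qed

context compact_group_on
begin

lemma continuous_on_translate_ratio:
  fixes f :: "'a \<Rightarrow> complex"
  assumes "continuous_on G f" "\<And>x. x \<in> G \<Longrightarrow> f x \<noteq> 0" "x \<in> G" "x' \<in> G"
  shows "continuous_on G (\<lambda>z. f (x' \<cdot> z) / f (x \<cdot> z))"
  using assms by (intro continuous_on_divide continuous_on_translate) auto

lemma translate_ratio_near_1:
  assumes f: "continuous_on G f" and nz: "\<And>x. x \<in> G \<Longrightarrow> f x \<noteq> (0::complex)" and "\<eta> > 0"
  obtains \<delta> where "\<delta> > 0"
    "\<And>x x' z. x \<in> G \<Longrightarrow> x' \<in> G \<Longrightarrow> z \<in> G \<Longrightarrow> dist x' x < \<delta> \<Longrightarrow>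
      cmod (f (x' \<cdot> z) / f (x \<cdot> z) - 1) < \<eta>"
proof -
  have "\<exists>a\<in>G. \<forall>x\<in>G. cmod (f a) \<le> cmod (f x)"
    by (rule continuous_attains_inf[OF compact]) (use one_in in blast, intro continuous_intros f)
  then obtain a where a: "a \<in> G" "\<And>x. x \<in> G \<Longrightarrow> cmod (f a) \<le> cmod (f x)" by blast
  have pos: "0 < \<eta> * cmod (f a)" using \<open>\<eta> > 0\<close> nz[OF a(1)] by simp
  have "continuous_on (G \<times> G) (\<lambda>p. f (fst p \<cdot> snd p))"
    by (rule continuous_on_compose2[OF f]) (auto intro!: continuous_intros)
  then have "uniformly_continuous_on (G \<times> G) (\<lambda>p. f (fst p \<cdot> snd p))"
    by (intro compact_uniformly_continuous compact_Times compact)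
  then obtain \<delta> where \<delta>: "\<delta> > 0" and
    *: "\<And>p q. p \<in> G \<times> G \<Longrightarrow> q \<in> G \<times> G \<Longrightarrow> dist q p < \<delta> \<Longrightarrow>
      dist (f (fst q \<cdot> snd q)) (f (fst p \<cdot> snd p)) < \<eta> * cmod (f a)"
    using pos unfolding uniformly_continuous_on_def by metis
  show ?thesis
  proof (rule that[OF \<delta>])
    fix x x' z assume x: "x \<in> G" "x' \<in> G" "z \<in> G" "dist x' x < \<delta>"
    then have "cmod (f (x' \<cdot> z) - f (x \<cdot> z)) < \<eta> * cmod (f a)"
      using *[of "(x, z)" "(x', z)"] by (simp add: dist_Pair_Pair dist_norm)
    also have "\<dots> \<le> \<eta> * cmod (f (x \<cdot> z))" using a(2)[of "x \<cdot> z"] x \<open>\<eta> > 0\<close> by simp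
    finally have "cmod (f (x' \<cdot> z) - f (x \<cdot> z)) / cmod (f (x \<cdot> z)) < \<eta>"
      using nz[of "x \<cdot> z"] x by (simp add: divide_less_eq)
    also have "cmod (f (x' \<cdot> z) - f (x \<cdot> z)) / cmod (f (x \<cdot> z)) = cmod (f (x' \<cdot> z) / f (x \<cdot> z) - 1)"
      using nz[of "x \<cdot> z"] x by (simp add: norm_divide[symmetric] diff_divide_distrib)
    finally show "cmod (f (x' \<cdot> z) / f (x \<cdot> z) - 1) < \<eta>" .
  qed
qed

text \<open>
  The existence of a continuous logarithm is a clopen condition on \<open>x\<close>, because for nearby \<open>x\<close> and \<open>x'\<close> the
  two quotients differ by a factor close to \<open>1\<close>, whose principal logarithm is continuous.
\<close>

lemma translate_logarithm:
  assumes conn: "connected G"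
    and f: "continuous_on G f" and nz: "\<And>x. x \<in> G \<Longrightarrow> f x \<noteq> (0::complex)"
    and "x \<in> G"
  shows "\<exists>L. continuous_on G L \<and> (\<forall>z\<in>G. exp (L z) = f (x \<cdot> z) / f z)"
proof -
  obtain \<delta> where \<delta>: "\<delta> > 0"
    "\<And>x x' z. x \<in> G \<Longrightarrow> x' \<in> G \<Longrightarrow> z \<in> G \<Longrightarrow> dist x' x < \<delta> \<Longrightarrow>
      cmod (f (x' \<cdot> z) / f (x \<cdot> z) - 1) < 1"
    using translate_ratio_near_1[OF f nz, of 1] by auto
  have step: "\<exists>L. continuous_on G L \<and> (\<forall>z\<in>G. exp (L z) = f (x' \<cdot> z) / f z)"
    if x: "x \<in> G" "x' \<in> G" "dist x' x < \<delta>"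
      and log_x: "\<exists>L. continuous_on G L \<and> (\<forall>z\<in>G. exp (L z) = f (x \<cdot> z) / f z)" for x x'
  proof -
    obtain L where L: "continuous_on G L" "\<And>z. z \<in> G \<Longrightarrow> exp (L z) = f (x \<cdot> z) / f z"
      using log_x by blast
    have "continuous_on G (\<lambda>z. L z + Ln (f (x' \<cdot> z) / f (x \<cdot> z)))"
      using \<delta>(2) x by (intro continuous_on_add L(1) continuous_on_Ln_near_1
          continuous_on_translate_ratio f nz) auto
    moreover have "exp (L z + Ln (f (x' \<cdot> z) / f (x \<cdot> z))) = f (x' \<cdot> z) / f z" if "z \<in> G" for z
      using nz[of "x \<cdot> z"] nz[of "x' \<cdot> z"] x that by (simp add: exp_add L)
    ultimately show ?thesis by blast
  qed
  show ?thesis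
  proof (rule connected_induction_simple[OF conn one_in \<open>x \<in> G\<close>])
    show "\<exists>L. continuous_on G L \<and> (\<forall>z\<in>G. exp (L z) = f (e \<cdot> z) / f z)"
      using nz by (intro exI[of _ "\<lambda>_. 0"]) (auto simp: continuous_on_const)
    fix a assume "a \<in> G"
    show "\<exists>T. openin (top_of_set G) T \<and> a \<in> T \<and>
      (\<forall>x\<in>T. \<forall>y\<in>T. (\<exists>L. continuous_on G L \<and> (\<forall>z\<in>G. exp (L z) = f (x \<cdot> z) / f z)) \<longrightarrow>
        (\<exists>L. continuous_on G L \<and> (\<forall>z\<in>G. exp (L z) = f (y \<cdot> z) / f z)))"
    proof (intro exI[of _ "G \<inter> ball a (\<delta> / 2)"] conjI ballI impI)
      fix x y assume "x \<in> G \<inter> ball a (\<delta> / 2)" "y \<in> G \<inter> ball a (\<delta> / 2)"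
        and L: "\<exists>L. continuous_on G L \<and> (\<forall>z\<in>G. exp (L z) = f (x \<cdot> z) / f z)"
      then have "x \<in> G" "y \<in> G" "dist y x < \<delta>"
        using dist_triangle_half_l[of y a \<delta> x] by (auto simp: dist_commute)
      then show "\<exists>L. continuous_on G L \<and> (\<forall>z\<in>G. exp (L z) = f (y \<cdot> z) / f z)"
        using L by (rule step)
    qed (use \<open>a \<in> G\<close> \<delta> in auto)
  qed
qed

text \<open>
  The quotient \<open>f (x z) / f z\<close>, as a function of \<open>z\<close>, is \<open>exp (L x z)\<close>. The logarithm \<open>L x\<close> is
  determined up to a multiple of \<open>2\<pi>i\<close>, and \<open>L (x y) z\<close> agrees with \<open>L x (y z) + L y z\<close> up to such a multiple.
  Left invariance of the mean therefore makes the mean \<open>\<beta> x\<close> of \<open>Im (L x)\<close> additive modulo \<open>2\<pi>\<close>: the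
  character is \<open>exp (i \<beta>)\<close>. The difference \<open>b x = Im (L x 1) - \<beta> x\<close> does not depend on the choice of the
  logarithm, which is why it is a continuous single-valued function.
\<close>

theorem phase_factorization:
  assumes conn: "connected G"
    and f: "continuous_on G f" and nz: "\<And>x. x \<in> G \<Longrightarrow> f x \<noteq> (0::complex)"
  obtains u :: "'a \<Rightarrow> complex" and b :: "'a \<Rightarrow> real" where
    "\<And>x y. x \<in> G \<Longrightarrow> y \<in> G \<Longrightarrow> u (x \<cdot> y) = u x * u y"
    "\<And>x. x \<in> G \<Longrightarrow> cmod (u x) = 1"
    "continuous_on G b"
    "\<And>x. x \<in> G \<Longrightarrow> f x = of_real (cmod (f x)) * sgn (f e) * u x * cis (b x)"
proof -
  obtain L where L: "\<And>x. x \<in> G \<Longrightarrow> continuous_on G (L x)"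
    and expL: "\<And>x z. x \<in> G \<Longrightarrow> z \<in> G \<Longrightarrow> exp (L x z) = f (x \<cdot> z) / f z"
    using translate_logarithm[OF conn f nz] by metis
  define \<beta> where "\<beta> x = mean (\<lambda>z. Im (L x z))" for x
  (* Changing the branch of the logarithm changes the mean by the same multiple of 2 pi. *)
  have \<beta>_shift: "\<beta> x = mean (\<lambda>z. Im (K z)) + 2 * pi * of_int n"
    if "x \<in> G" "continuous_on G K" "\<And>z. z \<in> G \<Longrightarrow> L x z = K z + of_int (2 * n) * pi * \<i>" for x K n
  proof -
    have "\<beta> x = mean (\<lambda>z. Im (K z) + 2 * pi * of_int n)"
      unfolding \<beta>_def by (rule mean_cong) (auto intro!: continuous_intros L that simp: that)
    also have "\<dots> = mean (\<lambda>z. Im (K z)) + 2 * pi * of_int n"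
      by (subst mean_add) (auto intro!: continuous_intros that)
    finally show ?thesis .
  qed
  define b where "b x = Im (L x e) - \<beta> x" for x
  have mult: "cis (\<beta> (x \<cdot> y)) = cis (\<beta> x) * cis (\<beta> y)" if x: "x \<in> G" and y: "y \<in> G" for x y
  proof -
    have c: "continuous_on G (\<lambda>z. L x (y \<cdot> z) + L y z)"
      by (intro continuous_intros continuous_on_translate L x y)
    have "exp (L (x \<cdot> y) z) = exp (L x (y \<cdot> z) + L y z)" if "z \<in> G" for z
      using x y that nz[of "y \<cdot> z"] by (simp add: exp_add expL assoc)
    then obtain n :: int where
      "\<And>z. z \<in> G \<Longrightarrow> L (x \<cdot> y) z = L x (y \<cdot> z) + L y z + of_int (2 * n) * pi * \<i>"
      using continuous_logarithms_differ_by_constant[OF conn L[OF mul_in[OF x y]] c] by metis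
    then have "\<beta> (x \<cdot> y) = mean (\<lambda>z. Im (L x (y \<cdot> z) + L y z)) + 2 * pi * of_int n"
      by (intro \<beta>_shift mul_in x y c)
    also have "mean (\<lambda>z. Im (L x (y \<cdot> z) + L y z)) = mean (\<lambda>z. Im (L x (y \<cdot> z))) + \<beta> y"
      unfolding \<beta>_def plus_complex.sel
      by (intro mean_add continuous_intros continuous_on_translate L x y)
    also have "mean (\<lambda>z. Im (L x (y \<cdot> z))) = \<beta> x"
      unfolding \<beta>_def using mean_translate[of "\<lambda>z. Im (L x z)" y] x y L
      by (auto intro!: continuous_intros)
    finally have "cis (\<beta> (x \<cdot> y)) = cis (\<beta> x) * cis (\<beta> y) * cis (2 * pi * of_int n)"
      by (simp only: cis_mult)
    then show ?thesis by simp
  qed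
  have b: "continuous_on G b"
  proof (rule continuous_on_iff[THEN iffD2], intro ballI allI impI)
    fix x \<epsilon> assume x: "x \<in> G" and "\<epsilon> > (0::real)"
    have "isCont Ln 1" by (intro continuous_at_Ln) (simp add: complex_nonpos_Reals_iff)
    then obtain \<eta> where \<eta>: "\<eta> > 0" "\<And>w. cmod (w - 1) < \<eta> \<Longrightarrow> cmod (Ln w) < \<epsilon> / 3"
      using \<open>\<epsilon> > 0\<close> unfolding continuous_at_eps_delta
      by (metis dist_norm Ln_1 diff_zero zero_less_divide_iff zero_less_numeral)
    obtain \<delta> where \<delta>: "\<delta> > 0"
      "\<And>x x' z. x \<in> G \<Longrightarrow> x' \<in> G \<Longrightarrow> z \<in> G \<Longrightarrow> dist x' x < \<delta> \<Longrightarrow>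
        cmod (f (x' \<cdot> z) / f (x \<cdot> z) - 1) < min \<eta> 1"
      using translate_ratio_near_1[OF f nz, of "min \<eta> 1"] \<eta>(1) by auto
    show "\<exists>\<delta>>0. \<forall>x'\<in>G. dist x' x < \<delta> \<longrightarrow> dist (b x') (b x) < \<epsilon>"
    proof (intro exI[of _ \<delta>] conjI ballI impI \<delta>(1))
      fix x' assume x': "x' \<in> G" "dist x' x < \<delta>"
      define \<Lambda> where "\<Lambda> z = Ln (f (x' \<cdot> z) / f (x \<cdot> z))" for z
      have small: "cmod (\<Lambda> z) < \<epsilon> / 3" if "z \<in> G" for z
        unfolding \<Lambda>_def using \<delta>(2)[OF x x'(1) that x'(2)] by (intro \<eta>(2)) simp
      have c\<Lambda>: "continuous_on G \<Lambda>"
        unfolding \<Lambda>_def using \<delta>(2)[OF x x'(1) _ x'(2)] x x'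
        by (intro continuous_on_Ln_near_1 continuous_on_translate_ratio f nz) auto
      then have c: "continuous_on G (\<lambda>z. L x z + \<Lambda> z)" by (intro continuous_intros L x)
      have "exp (L x' z) = exp (L x z + \<Lambda> z)" if "z \<in> G" for z
        using x x' that nz[of "x \<cdot> z"] nz[of "x' \<cdot> z"] by (simp add: exp_add expL \<Lambda>_def)
      then obtain n :: int where
        n: "\<And>z. z \<in> G \<Longrightarrow> L x' z = L x z + \<Lambda> z + of_int (2 * n) * pi * \<i>"
        using continuous_logarithms_differ_by_constant[OF conn L[OF x'(1)] c] by metis
      then have "\<beta> x' = mean (\<lambda>z. Im (L x z + \<Lambda> z)) + 2 * pi * of_int n"
        by (intro \<beta>_shift x' c)
      also have "mean (\<lambda>z. Im (L x z + \<Lambda> z)) = \<beta> x + mean (\<lambda>z. Im (\<Lambda> z))"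
        unfolding \<beta>_def plus_complex.sel by (intro mean_add continuous_intros L x c\<Lambda>)
      finally have "b x' - b x = Im (\<Lambda> e) - mean (\<lambda>z. Im (\<Lambda> z))"
        unfolding b_def n[OF one_in] by simp
      moreover have bound: "- (\<epsilon> / 3) \<le> Im (\<Lambda> z) \<and> Im (\<Lambda> z) \<le> \<epsilon> / 3" if "z \<in> G" for z
        using small[OF that] abs_Im_le_cmod[of "\<Lambda> z"] by linarith
      moreover have "- (\<epsilon> / 3) \<le> mean (\<lambda>z. Im (\<Lambda> z)) \<and> mean (\<lambda>z. Im (\<Lambda> z)) \<le> \<epsilon> / 3"
        by (intro mean_bounds continuous_intros c\<Lambda> bound)
      ultimately have "\<bar>b x' - b x\<bar> < \<epsilon>" using \<open>\<epsilon> > 0\<close> bound[OF one_in] by linarith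
      then show "dist (b x') (b x) < \<epsilon>" by (simp add: dist_real_def)
    qed
  qed
  have "f x = of_real (cmod (f x)) * sgn (f e) * cis (\<beta> x) * cis (b x)" if x: "x \<in> G" for x
  proof -
    (* Evaluate f (x z) / f z = exp (L x z) at the unit z = e. *)
    have fx: "f x = f e * exp (L x e)" using expL[OF x one_in] nz[OF one_in] by simp
    have "exp (L x e) = of_real (exp (Re (L x e))) * (cis (\<beta> x) * cis (b x))"
      by (simp add: exp_eq_polar cis_mult b_def)
    moreover have "f e = of_real (cmod (f e)) * sgn (f e)"
      by (simp add: sgn_div_norm scaleR_conv_of_real nz)
    ultimately have "f x = (of_real (cmod (f e)) * sgn (f e)) *
        (of_real (exp (Re (L x e))) * (cis (\<beta> x) * cis (b x)))"
      using fx by metis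
    then have "f x = of_real (cmod (f e) * exp (Re (L x e))) * sgn (f e) * cis (\<beta> x) * cis (b x)"
      by (simp only: of_real_mult mult_ac)
    moreover have "cmod (f x) = cmod (f e) * exp (Re (L x e))"
      by (subst fx) (simp add: norm_mult)
    ultimately show ?thesis by simp
  qed
  then show ?thesis using mult b by (intro that[of "\<lambda>x. cis (\<beta> x)" b]) auto
qed

end

section \<open>Schur's lemma and hyperplanes\<close>

context complex_linear_space
begin

text \<open>
  The vector \<open>p(T) x\<close>, by Horner's scheme.
\<close>

definition poly_apply :: "complex poly \<Rightarrow> ('v \<Rightarrow> 'v) \<Rightarrow> 'v \<Rightarrow> 'v" where
  "poly_apply p T x = fold_coeffs (\<lambda>a w. smul a x + T w) p 0"

context
  fixes T :: "'v \<Rightarrow> 'v" and x :: 'v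
  assumes T: "Vector_Spaces.linear smul smul T"
begin

interpretation T: Vector_Spaces.linear smul smul T by (rule T)

lemma poly_apply_0: "poly_apply 0 T x = 0"
  by (simp add: poly_apply_def)

lemma poly_apply_pCons: "poly_apply (pCons a p) T x = smul a x + T (poly_apply p T x)"
  by (cases "pCons a p = 0") (auto simp: poly_apply_def fold_coeffs_pCons_coeff_not_0_eq
      fold_coeffs_pCons_not_0_0_eq)

lemma poly_apply_add: "poly_apply (p + q) T x = poly_apply p T x + poly_apply q T x"
  by (induction p q rule: poly_induct2)
     (auto simp: poly_apply_0 poly_apply_pCons T.add scale_left_distrib)

lemma poly_apply_smult: "poly_apply (smult c p) T x = smul c (poly_apply p T x)"
  by (induction p)
     (auto simp: poly_apply_0 poly_apply_pCons T.scale scale_right_distrib)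

lemma poly_apply_sum: "poly_apply (\<Sum>i\<in>I. p i) T x = (\<Sum>i\<in>I. poly_apply (p i) T x)"
  by (induction I rule: infinite_finite_induct) (auto simp: poly_apply_0 poly_apply_add)

lemma poly_apply_monom: "poly_apply (monom c n) T x = smul c ((T ^^ n) x)"
  by (induction n) (auto simp: monom_0 monom_Suc poly_apply_0 poly_apply_pCons T.scale)

lemma poly_apply_linear_factor:
  "poly_apply ([:- z, 1:] * q) T x = T (poly_apply q T x) - smul z (poly_apply q T x)"
proof -
  have "[:- z, 1:] * q = smult (- z) q + pCons 0 q" by simp
  then show ?thesis
    by (simp only: poly_apply_add poly_apply_smult poly_apply_pCons) simp
qed

text \<open>
  More vectors \<open>T\<^sup>i x\<close> than the real dimension are linearly dependent, even over the reals.
\<close>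

lemma annihilating_polynomial: "\<exists>p. p \<noteq> 0 \<and> poly_apply p T x = 0"
proof (cases "inj_on (\<lambda>i. (T ^^ i) x) {..DIM('v)}")
  case inj: True
  let ?S = "(\<lambda>i. (T ^^ i) x) ` {..DIM('v)}"
  have "real_vector.dependent ?S"
    by (rule dependent_biggerset) (simp add: card_image[OF inj])
  then obtain c w where w: "w \<in> ?S" "c w \<noteq> 0" and sum0: "(\<Sum>w\<in>?S. c w *\<^sub>R w) = 0"
    using real_vector.dependent_finite[of ?S] by auto
  define p where "p = (\<Sum>i\<le>DIM('v). monom (complex_of_real (c ((T ^^ i) x))) i)"
  obtain i where i: "i \<le> DIM('v)" "w = (T ^^ i) x" using w by auto
  have "coeff p i = complex_of_real (c w)"
    unfolding p_def coeff_sum using i by (simp add: coeff_monom if_distrib cong: if_cong)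
  then have "p \<noteq> 0" using w(2) by auto
  moreover have "poly_apply p T x = (\<Sum>i\<le>DIM('v). c ((T ^^ i) x) *\<^sub>R (T ^^ i) x)"
    unfolding p_def poly_apply_sum poly_apply_monom smul_of_real ..
  then have "poly_apply p T x = 0" using sum0 by (simp add: sum.reindex[OF inj])
  ultimately show ?thesis by blast
next
  case False
  then obtain i j where ij: "(T ^^ i) x = (T ^^ j) x" "i \<noteq> j" by (auto simp: inj_on_def)
  define p :: "complex poly" where "p = monom 1 i + monom (- 1) j"
  have "coeff p i = 1" using ij by (simp add: p_def)
  then have "p \<noteq> 0" by auto
  moreover have "poly_apply p T x = 0"
    using ij by (simp add: p_def poly_apply_add poly_apply_monom)
  ultimately show ?thesis by blast
qed

text \<open>
  Split off linear factors from a polynomial with \<open>p(T) x = 0\<close>. As \<open>x \<noteq> 0\<close>, at some step the quotient does not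
  annihilate \<open>x\<close>, and then it maps \<open>x\<close> to an eigenvector.
\<close>

lemma eigenvector_exists:
  assumes "x \<noteq> 0"
  shows "\<exists>z w. w \<noteq> 0 \<and> T w = smul z w"
proof -
  have "p \<noteq> 0 \<Longrightarrow> poly_apply p T x = 0 \<Longrightarrow> ?thesis" for p
  proof (induction "degree p" arbitrary: p rule: less_induct)
    case less
    show ?case
    proof (cases "degree p = 0")
      case True
      then obtain c where "p = [:c:]" by (rule degree_eq_zeroE)
      then show ?thesis using less.prems assms by (auto simp: poly_apply_pCons poly_apply_0)
    next
      case False
      then have "\<not> constant (poly p)" by (simp add: constant_degree)
      then obtain z where "poly p z = 0" using fundamental_theorem_of_algebra by blast
      then obtain q where q: "p = [:- z, 1:] * q" by (auto simp: poly_eq_0_iff_dvd elim: dvdE)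
      have "q \<noteq> 0" using less.prems q by auto
      have "degree q < degree p" unfolding q using \<open>q \<noteq> 0\<close> by (subst degree_mult_eq) auto
      have "T (poly_apply q T x) = smul z (poly_apply q T x)"
        using less.prems(2) unfolding q poly_apply_linear_factor by simp
      then show ?thesis
        using less.hyps[OF \<open>degree q < degree p\<close> \<open>q \<noteq> 0\<close>] by blast
    qed
  qed
  then show ?thesis using annihilating_polynomial by blast
qed

end

text \<open>
  An eigenspace of \<open>T\<close> is invariant under all linear maps that commute with \<open>T\<close>; if these
  act irreducibly, it is the whole space.
\<close>

lemma Schur:
  assumes irr: "irreducible_on smul G"
    and T: "Vector_Spaces.linear smul smul T"
    and comm: "\<And>g w. g \<in> G \<Longrightarrow> blinfun_apply g (T w) = T (blinfun_apply g w)"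
    and lin: "\<And>g. g \<in> G \<Longrightarrow> Vector_Spaces.linear smul smul (blinfun_apply g)"
    and "(x::'v) \<noteq> 0"
  obtains z where "\<And>w. T w = smul z w"
proof -
  interpret T: Vector_Spaces.linear smul smul T by (rule T)
  obtain z w where w: "w \<noteq> 0" "T w = smul z w" using eigenvector_exists[OF T \<open>x \<noteq> 0\<close>] by blast
  let ?W = "{w. T w = smul z w}"
  have "subspace ?W"
    by (auto simp: subspace_def T.add T.scale scale_right_distrib scale_left_commute)
  moreover have "?W \<noteq> {0}" using w by auto
  moreover have "\<forall>g\<in>G. \<forall>w\<in>?W. blinfun_apply g w \<in> ?W"
  proof (intro ballI)
    fix g w assume "g \<in> G" "w \<in> ?W"
    interpret g: Vector_Spaces.linear smul smul "blinfun_apply g" by (rule lin) fact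
    show "blinfun_apply g w \<in> ?W"
      using comm[OF \<open>g \<in> G\<close>, of w] \<open>w \<in> ?W\<close> by (simp add: g.scale)
  qed
  ultimately have "?W = UNIV" using irr unfolding irreducible_on_def by blast
  then show ?thesis using that[of z] by blast
qed

lemma finite_dim:
  assumes "dim (UNIV :: 'v set) > 0"
  obtains B where "finite_dimensional_vector_space smul B"
proof -
  obtain B where B: "independent B" "UNIV \<subseteq> span B" "card B = dim (UNIV :: 'v set)"
    using basis_exists[of UNIV] by metis
  then have "finite B" using assms card.infinite by fastforce
  then have "finite_dimensional_vector_space smul B"
    using B by unfold_locales auto
  then show ?thesis by (rule that)
qed

text \<open>
  A basis of \<open>H\<close> and one vector outside form a basis of the space; take the coordinate of that vector.
\<close>

lemma hyperplane_functional:
  assumes H: "subspace H" and dim: "dim H + 1 = dim (UNIV :: 'v set)"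
  obtains l :: "'v \<Rightarrow> complex" where "Vector_Spaces.linear smul (*) l" "\<And>x. l x = 0 \<Longrightarrow> x \<in> H"
proof -
  have "dim (UNIV :: 'v set) > 0" using dim by linarith
  from finite_dim[OF this] obtain B0 where "finite_dimensional_vector_space smul B0" .
  then interpret fd: finite_dimensional_vector_space smul B0 .
  interpret C: vector_space "(*) :: complex \<Rightarrow> complex \<Rightarrow> complex"
    by unfold_locales (auto simp: algebra_simps)
  interpret p: vector_space_pair smul "(*) :: complex \<Rightarrow> complex \<Rightarrow> complex" ..
  obtain B where B: "B \<subseteq> H" "independent B" "H \<subseteq> span B" "card B = dim H"
    using basis_exists[of H] by metis
  have spanB: "span B = H" using B H by (metis span_subspace)
  have "H \<noteq> UNIV" using dim by auto
  then obtain w where w: "w \<notin> H" by blast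
  have ind: "independent (insert w B)" using B w spanB by (simp add: independent_insert)
  have finB: "finite B" using fd.finiteI_independent B(2) by blast
  have "card (insert w B) = dim (UNIV :: 'v set)"
    using B(1,4) w dim finB by (subst card_insert_disjoint) auto
  then have all: "span (insert w B) = UNIV"
    using fd.card_ge_dim_independent[of "insert w B" UNIV] ind by auto
  obtain l where l: "Vector_Spaces.linear smul (*) l"
    "\<forall>x\<in>insert w B. l x = (if x = w then 1 else (0::complex))"
    using p.linear_independent_extend[OF ind, of "\<lambda>x. if x = w then 1 else 0"] by blast
  interpret l: Vector_Spaces.linear smul "(*)" l by (rule l)
  have l0: "l x = 0" if "x \<in> span B" for x
    using that
  proof (induction rule: span_induct_alt)
    case (step c b y)
    then have "l b = 0" using l(2) B(1) w by auto
    then show ?case using step by (simp add: l.add l.scale)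
  qed simp
  show ?thesis
  proof (rule that[OF l(1)])
    fix x assume "l x = 0"
    have "x \<in> span (insert w B)" using all by simp
    then obtain k where k: "x - smul k w \<in> span B" using span_breakdown_eq by blast
    from l0[OF k] \<open>l x = 0\<close> l(2) have "k = 0" by (simp add: l.diff l.scale)
    then show "x \<in> H" using k spanB by simp
  qed
qed

end

section \<open>Compact groups of complex-linear maps\<close>

lemma norm_blinfun_compose3:
  "norm (f o\<^sub>L g o\<^sub>L h) \<le> norm f * norm g * norm h"
  using norm_blinfun_compose[of "f o\<^sub>L g" h] norm_blinfun_compose[of f g]
  by (meson mult_right_mono norm_ge_zero order_trans)

lemma continuous_on_linear_image:
  fixes T :: "'b::euclidean_space \<Rightarrow> 'c::real_normed_vector"
  assumes "continuous_on S F" "linear T"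
  shows "continuous_on S (\<lambda>x. T (F x))"
  using bounded_linear.continuous_on[of T S F] assms by (simp add: linear_conv_bounded_linear)

text \<open>
  A compact subgroup of \<open>GL\<close> is a compact group for the norm topology, with inversion written \<open>iv\<close>.
\<close>

locale compact_linear_group = complex_linear_space smul
  for smul :: "complex \<Rightarrow> 'v::euclidean_space \<Rightarrow> 'v" +
  fixes G :: "('v \<Rightarrow>\<^sub>L 'v) set"
  assumes subgroup: "subgroup G (GL smul)" and compact_G: "compact G"
begin

definition iv :: "('v \<Rightarrow>\<^sub>L 'v) \<Rightarrow> ('v \<Rightarrow>\<^sub>L 'v)" where
  "iv g = inv\<^bsub>GL smul\<^esub> g"

lemma linear_G: "g \<in> G \<Longrightarrow> Vector_Spaces.linear smul smul (blinfun_apply g)"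
  using subgroup.subset[OF subgroup] by (auto simp: GL_def)

lemma iv_in [simp]: "g \<in> G \<Longrightarrow> iv g \<in> G"
  unfolding iv_def by (rule subgroup.m_inv_closed[OF subgroup])

lemma iv_left [simp]: "g \<in> G \<Longrightarrow> iv g o\<^sub>L g = id_blinfun"
  and iv_right [simp]: "g \<in> G \<Longrightarrow> g o\<^sub>L iv g = id_blinfun"
  using group.l_inv[OF group_GL, of g] group.r_inv[OF group_GL, of g]
    subgroup.subset[OF subgroup]
  by (auto simp: iv_def GL_def)

lemma iv_apply [simp]:
  assumes "g \<in> G" shows "iv g (g w) = w" "g (iv g w) = w"
  using arg_cong[OF iv_left[OF assms], of "\<lambda>h. h w"] arg_cong[OF iv_right[OF assms], of "\<lambda>h. h w"]
  by simp_all

lemma mult_in [simp]: "g \<in> G \<Longrightarrow> h \<in> G \<Longrightarrow> g o\<^sub>L h \<in> G"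
  using subgroup.m_closed[OF subgroup] by (simp add: GL_def)

lemma id_in [simp]: "id_blinfun \<in> G"
  using subgroup.one_closed[OF subgroup] by (simp add: GL_def)

sublocale K: compact_group_on G "(o\<^sub>L)" id_blinfun
proof
  show "continuous_on (G \<times> G) (\<lambda>(x, y). x o\<^sub>L y)"
    unfolding case_prod_unfold by (intro continuous_intros)
  show "\<exists>h\<in>G. h o\<^sub>L g = id_blinfun \<and> g o\<^sub>L h = id_blinfun" if "g \<in> G" for g
    using that by (intro bexI[of _ "iv g"]) auto
  show "x o\<^sub>L y o\<^sub>L z = x o\<^sub>L (y o\<^sub>L z)" "id_blinfun o\<^sub>L x = x" "x o\<^sub>L id_blinfun = x"
    for x y z :: "'v \<Rightarrow>\<^sub>L 'v"
    by (rule blinfun_eqI, simp)+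
  show "id_blinfun \<in> G" by (rule id_in)
  show "compact G" by (rule compact_G)
  show "x o\<^sub>L y \<in> G" if "x \<in> G" "y \<in> G" for x y using that by (rule mult_in)
qed

lemma iv_mult:
  assumes g: "g \<in> G" and h: "h \<in> G"
  shows "iv (g o\<^sub>L h) w = iv h (iv g w)"
proof -
  define z where "z = iv (g o\<^sub>L h) w"
  have "w = (g o\<^sub>L h) z" unfolding z_def using g h by (intro iv_apply(2)[symmetric] mult_in)
  then have "w = g (h z)" by simp
  then have "iv h (iv g w) = z" using iv_apply(1)[OF g] iv_apply(1)[OF h] by metis
  then show ?thesis by (simp add: z_def)
qed

lemma bounded_G:
  obtains C where "C > 0" "\<And>g. g \<in> G \<Longrightarrow> norm g \<le> C"
  using compact_imp_bounded[OF compact_G] unfolding bounded_pos by blast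

text \<open>
  Inverses stay in the bounded set \<open>G\<close>, so \<open>g\<^sup>-\<^sup>1 - h\<^sup>-\<^sup>1 = g\<^sup>-\<^sup>1 (h - g) h\<^sup>-\<^sup>1\<close> makes inversion Lipschitz.
\<close>

lemma continuous_iv: "continuous_on G iv"
proof -
  obtain C where C: "C > 0" "\<And>g. g \<in> G \<Longrightarrow> norm g \<le> C" using bounded_G by blast
  have "(C * C)-lipschitz_on G iv"
  proof (rule lipschitz_onI)
    fix g h assume gh: "g \<in> G" "h \<in> G"
    have "iv g - iv h = iv g o\<^sub>L (h - g) o\<^sub>L iv h"
      by (rule blinfun_eqI) (simp add: blinfun.diff_left blinfun.diff_right gh)
    then have "norm (iv g - iv h) \<le> norm (iv g) * norm (h - g) * norm (iv h)"
      by (simp only: norm_blinfun_compose3)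
    also have "\<dots> \<le> C * norm (h - g) * C"
      using gh C by (intro mult_mono) auto
    finally show "dist (iv g) (iv h) \<le> C * C * dist g h"
      by (simp add: dist_norm norm_minus_commute mult_ac)
  qed (use C in auto)
  then show ?thesis by (rule lipschitz_on_continuous_on)
qed

definition conjugate :: "('v \<Rightarrow>\<^sub>L 'v) \<Rightarrow> ('v \<Rightarrow>\<^sub>L 'v) \<Rightarrow> ('v \<Rightarrow>\<^sub>L 'v)" where
  "conjugate y k = k o\<^sub>L y o\<^sub>L iv k"

lemma conjugate_in [simp]: "y \<in> G \<Longrightarrow> k \<in> G \<Longrightarrow> conjugate y k \<in> G"
  by (simp add: conjugate_def)

lemma continuous_conjugate [continuous_intros]: "continuous_on G (conjugate y)"
  unfolding conjugate_def by (intro continuous_intros continuous_iv)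

lemma continuous_conjugate_apply [continuous_intros]: "continuous_on G (\<lambda>k. conjugate y k w)"
  by (intro continuous_intros)

text \<open>
  The mean of the conjugacy class of \<open>y\<close>. It is complex linear and commutes with \<open>G\<close>, hence is a scalar
  if \<open>G\<close> is irreducible.
\<close>

definition conj_mean :: "('v \<Rightarrow>\<^sub>L 'v) \<Rightarrow> 'v \<Rightarrow> 'v" where
  "conj_mean y w = K.vmean (\<lambda>k. conjugate y k w)"

lemma real_linear_smul: "linear (smul c)"
  by (rule linearI) (simp_all add: scale_right_distrib scale_left_commute flip: smul_of_real)

lemma real_linear_functional:
  assumes "Vector_Spaces.linear smul (*) (l :: 'v \<Rightarrow> complex)"
  shows "linear l"
proof -
  interpret l: Vector_Spaces.linear smul "(*)" l by fact
  show ?thesis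
    by (rule linearI) (simp_all add: l.add l.scale scaleR_conv_of_real flip: smul_of_real)
qed

lemma conj_mean_linear:
  assumes y: "y \<in> G"
  shows "Vector_Spaces.linear smul smul (conj_mean y)"
proof -
  have add: "conj_mean y (w + w') = conj_mean y w + conj_mean y w'" for w w'
    unfolding conj_mean_def blinfun.add_right by (intro K.vmean_add continuous_intros)
  have scale: "conj_mean y (smul c w) = smul c (conj_mean y w)" for c w
  proof -
    have "conj_mean y (smul c w) = K.vmean (\<lambda>k. smul c (conjugate y k w))"
      unfolding conj_mean_def
    proof (intro K.vmean_cong continuous_intros)
      fix k assume "k \<in> G"
      then interpret k: Vector_Spaces.linear smul smul "blinfun_apply (conjugate y k)"
        using y by (intro linear_G) simp
      show "conjugate y k (smul c w) = smul c (conjugate y k w)" by (rule k.scale)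
    qed
    also have "\<dots> = smul c (conj_mean y w)"
      unfolding conj_mean_def by (intro K.vmean_linear_image continuous_intros real_linear_smul)
    finally show ?thesis .
  qed
  show ?thesis by unfold_locales (auto simp: add scale)
qed

lemma conj_mean_commute:
  assumes "y \<in> G" and h: "h \<in> G"
  shows "h (conj_mean y w) = conj_mean y (h w)"
proof -
  have "h (conj_mean y w) = K.vmean (\<lambda>k. h (conjugate y k w))"
    unfolding conj_mean_def using K.vmean_linear_image[OF continuous_conjugate_apply
        bounded_linear.linear[OF blinfun.bounded_linear_right[of h]], of y w] by simp
  also have "\<dots> = K.vmean (\<lambda>k. conjugate y (h o\<^sub>L k) (h w))"
    by (intro K.vmean_cong continuous_intros) (simp add: conjugate_def iv_mult h)
  also have "\<dots> = conj_mean y (h w)"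
    unfolding conj_mean_def by (intro K.vmean_translate[of "\<lambda>k. conjugate y k (h w)"] continuous_intros h)
  finally show ?thesis .
qed

text \<open>
  An invariant inner product. The inverses turn left invariance of the mean into
  \<open>ip (h u) (h w) = ip u w\<close>.
\<close>

definition ip :: "'v \<Rightarrow> 'v \<Rightarrow> real" where
  "ip u w = K.mean (\<lambda>g. iv g u \<bullet> iv g w)"

lemma continuous_ip: "continuous_on G (\<lambda>g. iv g u \<bullet> iv g w)"
  by (intro continuous_intros continuous_iv)

lemma ip_commute: "ip u w = ip w u"
  by (simp add: ip_def inner_commute)

lemma linear_ip: "linear (\<lambda>u. ip u w)"
proof (rule linearI)
  show "ip (u + v) w = ip u w + ip v w" for u v
    unfolding ip_def blinfun.add_right inner_add_left by (intro K.mean_add continuous_ip)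
  show "ip (c *\<^sub>R u) w = c *\<^sub>R ip u w" for c u
    unfolding ip_def using K.mean_mult_right[OF continuous_ip[of u w], of c]
    by (simp add: blinfun.scaleR_right mult.commute)
qed

lemma ip_invariant:
  assumes h: "h \<in> G"
  shows "ip (h u) (h w) = ip u w"
proof -
  have "ip (h u) (h w) = K.mean (\<lambda>g. iv (h o\<^sub>L g) (h u) \<bullet> iv (h o\<^sub>L g) (h w))"
    unfolding ip_def using K.mean_translate[OF continuous_ip h] by simp
  also have "\<dots> = ip u w"
    unfolding ip_def
    by (rule K.mean_cong[OF continuous_ip, symmetric]) (simp add: iv_mult h)
  finally show ?thesis .
qed

lemma ip_nonneg: "0 \<le> ip u u"
  using K.mean_mono[OF _ continuous_ip, of "\<lambda>_. 0" u u] by (simp add: ip_def continuous_on_const)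

lemma ip_eq_0:
  assumes "ip u u \<le> 0" shows "u = 0"
proof -
  have "iv id_blinfun u \<bullet> iv id_blinfun u = 0"
    using assms by (intro K.mean_eq_0[OF continuous_ip]) (auto simp: ip_def)
  moreover have "iv id_blinfun u = u" using iv_apply(1)[OF id_in, of u] by simp
  ultimately show ?thesis by simp
qed

text \<open>
  For the invariant norm, the mean of \<open>\<parallel>s w - w\<parallel>\<^sup>2\<close> over the conjugates \<open>s\<close> of \<open>y\<close> is
  \<open>2 (1 - t) \<parallel>w\<parallel>\<^sup>2 \<le> 0\<close>, so every conjugate fixes every \<open>w\<close>.
\<close>

lemma id_of_conj_mean_ge_1:
  assumes y: "y \<in> G" and t: "t \<ge> 1" and eq: "\<And>w. conj_mean y w = t *\<^sub>R w"
  shows "y = id_blinfun"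
proof (rule blinfun_eqI)
  fix w
  have c: "continuous_on G (\<lambda>k. ip (conjugate y k w) w)"
    using continuous_on_linear_image[OF continuous_conjugate_apply linear_ip] .
  have expand: "ip (s w - w) (s w - w) = 2 * ip w w - 2 * ip (s w) w" if "s \<in> G" for s
  proof -
    have left: "ip (p - q) r = ip p r - ip q r" for p q r by (rule linear_diff[OF linear_ip])
    have right: "ip r (p - q) = ip r p - ip r q" for p q r
      using left[of p q r] by (simp add: ip_commute)
    have "ip (s w - w) (s w - w) = ip (s w) (s w) - ip (s w) w - (ip (s w) w - ip w w)"
      using ip_commute[of w "s w"] by (simp add: left right)
    then show ?thesis by (simp add: ip_invariant that)
  qed
  have "K.mean (\<lambda>k. ip (conjugate y k w) w) = t * ip w w"
    using K.mean_linear_functional[OF continuous_conjugate_apply linear_ip]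
    by (simp add: conj_mean_def[symmetric] eq linear_cmul[OF linear_ip])
  then have "K.mean (\<lambda>k. 2 * ip w w + - 2 * ip (conjugate y k w) w) = 2 * (1 - t) * ip w w"
    using K.mean_linear[OF continuous_on_const[of G "1::real"] c, of "2 * ip w w" "- 2"]
    by (simp add: algebra_simps)
  also have "\<dots> \<le> 0" using t ip_nonneg[of w] by (simp add: mult_nonpos_nonneg)
  finally have m: "K.mean (\<lambda>k. 2 * ip w w + - 2 * ip (conjugate y k w) w) \<le> 0" .
  have "2 * ip w w + - 2 * ip (conjugate y id_blinfun w) w = 0"
  proof (rule K.mean_eq_0[OF _ _ m id_in])
    show "continuous_on G (\<lambda>k. 2 * ip w w + - 2 * ip (conjugate y k w) w)"
      by (intro continuous_intros c)
    show "0 \<le> 2 * ip w w + - 2 * ip (conjugate y k w) w" if "k \<in> G" for k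
      using expand[of "conjugate y k"] y that ip_nonneg[of "conjugate y k w - w"] by simp
  qed
  moreover have "conjugate y id_blinfun w = y w"
    using iv_apply(1)[OF id_in, of w] by (simp add: conjugate_def)
  ultimately have "ip (y w - w) (y w - w) = 0" using expand[OF y] by simp
  then show "y w = id_blinfun w" using ip_eq_0[of "y w - w"] by simp
qed

text \<open>
  In an abelian group every element is a scalar by Schur's lemma, so that every line is invariant.
\<close>

lemma abelian_dim_le_1:
  assumes irr: "irreducible_on smul G"
    and comm: "\<And>g h. g \<in> G \<Longrightarrow> h \<in> G \<Longrightarrow> g o\<^sub>L h = h o\<^sub>L g"
    and v: "(v :: 'v) \<noteq> 0"
  shows "dim (UNIV :: 'v set) \<le> 1"
proof -
  have "g w \<in> span {v}" if g: "g \<in> G" and w: "w \<in> span {v}" for g w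
  proof -
    have "h (g w) = g (h w)" if "h \<in> G" for h w
      using arg_cong[OF comm[OF that g], of "\<lambda>f. f w"] by simp
    then obtain z where "\<And>w. g w = smul z w"
      using Schur[OF irr linear_G[OF g] _ linear_G v] by blast
    then show ?thesis using span_scale[OF w] by simp
  qed
  moreover have "span {v} \<noteq> {0}" using v span_base[of v "{v}"] by auto
  ultimately have "span {v} = UNIV"
    using irr subspace_span unfolding irreducible_on_def by blast
  then show ?thesis using dim_le_card[of UNIV "{v}"] by simp
qed

text \<open>
  For fixed \<open>a\<close> the distance of the commutator \<open>a c a\<^sup>-\<^sup>1 c\<^sup>-\<^sup>1\<close> from the identity is a continuous function of \<open>c\<close> on
  a connected set. It vanishes at the identity and not everywhere, so it takes all small positive values.
\<close>

lemma small_commutator: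
  assumes conn: "connected G" and ac: "a \<in> G" "c \<in> G" "a o\<^sub>L c \<noteq> c o\<^sub>L a" and "\<eta> > 0"
  obtains c' where "c' \<in> G" "a o\<^sub>L c' o\<^sub>L iv a o\<^sub>L iv c' \<noteq> id_blinfun"
    "norm ((a o\<^sub>L c' o\<^sub>L iv a o\<^sub>L iv c') - id_blinfun) < \<eta>"
proof -
  define \<phi> where "\<phi> c = norm ((a o\<^sub>L c o\<^sub>L iv a o\<^sub>L iv c) - id_blinfun)" for c
  have "continuous_on G \<phi>" unfolding \<phi>_def by (intro continuous_intros continuous_iv)
  then have conn': "connected (\<phi> ` G)" using conn by (rule connected_continuous_image)
  have "\<phi> id_blinfun = 0"
  proof -
    have "a o\<^sub>L id_blinfun o\<^sub>L iv a o\<^sub>L iv id_blinfun = id_blinfun"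
      using iv_apply(1)[OF id_in] ac(1) by (intro blinfun_eqI) simp
    then show ?thesis by (simp only: \<phi>_def diff_self norm_zero)
  qed
  then have zero: "0 \<in> \<phi> ` G" using id_in by force
  have "\<phi> c > 0"
  proof -
    have "a o\<^sub>L c = c o\<^sub>L a" if eq: "a o\<^sub>L c o\<^sub>L iv a o\<^sub>L iv c = id_blinfun"
    proof (rule blinfun_eqI)
      fix w
      show "(a o\<^sub>L c) w = (c o\<^sub>L a) w"
        using arg_cong[OF eq, of "\<lambda>h. h (c (a w))"] ac by simp
    qed
    then show ?thesis using ac by (auto simp: \<phi>_def)
  qed
  define r where "r = min (\<phi> c) (\<eta> / 2)"
  have r: "0 < r" "r \<le> \<phi> c" "r < \<eta>" using \<open>\<phi> c > 0\<close> \<open>\<eta> > 0\<close> by (auto simp: r_def)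
  have "r \<in> \<phi> ` G"
    using connectedD_interval[OF conn' zero imageI[OF ac(2)]] r by simp
  then obtain c' where "c' \<in> G" "\<phi> c' = r" by auto
  then show ?thesis using r by (intro that[of c']) (auto simp: \<phi>_def)
qed

text \<open>
  The maximum principle for the phase \<open>b\<close> of \<open>f x = l (x v)\<close>. For \<open>s = k y k\<^sup>-\<^sup>1\<close> the quotient \<open>f (x s) / f x\<close> has
  modulus \<open>R x k\<close> and argument \<open>d x k = b (x s) - b x\<close>, since \<open>u s = u y = 1\<close>, and its mean over \<open>k\<close> is \<open>\<mu>\<close>
  for every \<open>x\<close>. The bound \<open>\<bar>d x k\<bar> < \<pi>\<close> makes \<open>sin (d x k)\<close> detect the sign of \<open>d x k\<close>.
\<close>

lemma conj_mean_scalar_ge_1: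
  fixes l :: "'v \<Rightarrow> complex"
  assumes l: "Vector_Spaces.linear smul (*) l"
    and nz: "\<And>g. g \<in> G \<Longrightarrow> l (g v) \<noteq> 0"
    and u_mult: "\<And>x y. x \<in> G \<Longrightarrow> y \<in> G \<Longrightarrow> u (x o\<^sub>L y) = u x * u y"
    and u_norm: "\<And>x. x \<in> G \<Longrightarrow> cmod (u x) = 1"
    and b: "continuous_on G b"
    and phase: "\<And>x. x \<in> G \<Longrightarrow> l (x v) = of_real (cmod (l (x v))) * C * u x * cis (b x)"
    and y: "y \<in> G" "u y = 1"
    and near: "\<And>x k. x \<in> G \<Longrightarrow> k \<in> G \<Longrightarrow> \<bar>b (x o\<^sub>L conjugate y k) - b x\<bar> < pi"
    and scalar: "\<And>w. conj_mean y w = smul \<mu> w"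
  shows "Im \<mu> = 0" "Re \<mu> \<ge> 1"
proof -
  interpret l: Vector_Spaces.linear smul "(*)" l by (rule l)
  have lin_l: "linear l" by (rule real_linear_functional[OF l])
  define f where "f x = l (x v)" for x :: "'v \<Rightarrow>\<^sub>L 'v"
  have cont_f: "continuous_on G f" unfolding f_def
    by (intro continuous_on_linear_image[OF _ lin_l] continuous_intros)
  define R where "R x k = cmod (f (x o\<^sub>L conjugate y k)) / cmod (f x)" for x k
  define d where "d x k = b (x o\<^sub>L conjugate y k) - b x" for x k
  have cont_shift: "continuous_on G (\<lambda>k. x o\<^sub>L conjugate y k)" for x by (intro continuous_intros)
  have cont_R: "continuous_on G (R x)" if "x \<in> G" for x
    unfolding R_def using that y nz[OF that]
    by (intro continuous_intros continuous_on_compose2[OF cont_f cont_shift]) (auto simp: f_def)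
  have cont_d: "continuous_on G (d x)" if "x \<in> G" for x
    unfolding d_def using that y by (intro continuous_intros continuous_on_compose2[OF b cont_shift]) auto
  have R_pos: "R x k > 0" if "x \<in> G" "k \<in> G" for x k
    using nz[of x] nz[of "x o\<^sub>L conjugate y k"] that y by (simp add: R_def f_def)
  have u_id: "u id_blinfun = 1"
    using u_mult[OF id_in id_in] u_norm[OF id_in] by auto
  have u_conjugate: "u (conjugate y k) = 1" if "k \<in> G" for k
    using u_mult[of "k o\<^sub>L y" "iv k"] u_mult[of k y] u_mult[of k "iv k"] that y u_id
    by (simp add: conjugate_def)
  have ratio: "f (x o\<^sub>L conjugate y k) / f x = of_real (R x k) * cis (d x k)" if "x \<in> G" "k \<in> G" for x k
  proof -
    have "u (x o\<^sub>L conjugate y k) = u x" using that y by (simp add: u_mult u_conjugate)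
    then have "f (x o\<^sub>L conjugate y k) = of_real (cmod (f (x o\<^sub>L conjugate y k))) * C * u x * cis (b (x o\<^sub>L conjugate y k))"
      using phase[of "x o\<^sub>L conjugate y k"] that y unfolding f_def by simp
    moreover have "f x = of_real (cmod (f x)) * C * u x * cis (b x)"
      using phase that(1) unfolding f_def .
    moreover have "C \<noteq> 0" "u x \<noteq> 0" "f x \<noteq> 0"
      using phase[OF that(1)] nz[OF that(1)] by (auto simp: f_def)
    ultimately have "f (x o\<^sub>L conjugate y k) / f x =
      (of_real (cmod (f (x o\<^sub>L conjugate y k))) * C * u x * cis (b (x o\<^sub>L conjugate y k))) /
      (of_real (cmod (f x)) * C * u x * cis (b x))" by metis
    also have "\<dots> = of_real (R x k) * (cis (b (x o\<^sub>L conjugate y k)) / cis (b x))"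
      using \<open>C \<noteq> 0\<close> \<open>u x \<noteq> 0\<close> by (simp add: R_def)
    finally show ?thesis by (simp add: cis_divide d_def)
  qed
  have mean_eq: "q \<mu> = K.mean (\<lambda>k. q (of_real (R x k) * cis (d x k)))"
    if x: "x \<in> G" and q: "linear q" for x and q :: "complex \<Rightarrow> real"
  proof -
    interpret x: Vector_Spaces.linear smul smul "blinfun_apply x" by (rule linear_G[OF x])
    have lin: "linear (\<lambda>w. q (l (x w) / f x))"
      using linear_compose[OF linear_compose[OF linear_compose[OF
          bounded_linear.linear[OF blinfun.bounded_linear_right[of x]] lin_l]
          bounded_linear.linear[OF bounded_linear_divide[of "f x"]]] q]
      by (simp add: o_def)
    have "K.mean (\<lambda>k. q (l (x (conjugate y k v)) / f x)) = q (l (x (conj_mean y v)) / f x)"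
      unfolding conj_mean_def using K.mean_linear_functional[OF continuous_conjugate_apply lin] .
    also have "l (x (conj_mean y v)) / f x = \<mu>"
      using nz[OF x] by (simp add: scalar x.scale l.scale f_def)
    finally have "q \<mu> = K.mean (\<lambda>k. q (l (x (conjugate y k v)) / f x))" ..
    also have "\<dots> = K.mean (\<lambda>k. q (of_real (R x k) * cis (d x k)))"
      by (intro K.mean_cong continuous_on_linear_image[OF continuous_conjugate_apply lin])
         (simp add: ratio[OF x, symmetric] f_def)
    finally show ?thesis .
  qed
  have Im_mean: "Im \<mu> = K.mean (\<lambda>k. R x k * sin (d x k))"
    and Re_mean: "Re \<mu> = K.mean (\<lambda>k. R x k * cos (d x k))" if "x \<in> G" for x
    using mean_eq[OF that bounded_linear.linear[OF bounded_linear_Im]]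
      mean_eq[OF that bounded_linear.linear[OF bounded_linear_Re]] by simp_all
  have cont_sin: "continuous_on G (\<lambda>k. R x k * sin (d x k))"
    and cont_cos: "continuous_on G (\<lambda>k. R x k * cos (d x k))" if "x \<in> G" for x
    using cont_R[OF that] cont_d[OF that] by (intro continuous_intros; simp)+
  have ne: "G \<noteq> {}" using id_in by blast
  obtain x1 where x1: "x1 \<in> G" "\<And>x. x \<in> G \<Longrightarrow> b x1 \<le> b x"
    using continuous_attains_inf[OF compact_G ne b] by blast
  obtain x0 where x0: "x0 \<in> G" "\<And>x. x \<in> G \<Longrightarrow> b x \<le> b x0"
    using continuous_attains_sup[OF compact_G ne b] by blast
  (* Where b is minimal all arguments d are nonnegative. *)
  have "0 \<le> Im \<mu>"
  proof -
    have "0 \<le> R x1 k * sin (d x1 k)" if "k \<in> G" for k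
    proof -
      have "0 \<le> d x1 k" "d x1 k < pi" using x1 that y near[OF x1(1) that] by (auto simp: d_def)
      then show ?thesis using R_pos[OF x1(1) that] by (simp add: sin_ge_zero)
    qed
    then have "K.mean (\<lambda>k. 0) \<le> K.mean (\<lambda>k. R x1 k * sin (d x1 k))"
      by (intro K.mean_mono cont_sin x1 continuous_on_const)
    then show ?thesis using Im_mean[OF x1(1)] by simp
  qed
  (* Where b is maximal all arguments d are nonpositive. *)
  have nonneg: "0 \<le> R x k * sin (- d x k)" and d_range: "0 \<le> - d x k" "- d x k < pi"
    if "x \<in> G" "b x = b x0" "k \<in> G" for x k
  proof -
    show "0 \<le> - d x k" "- d x k < pi"
      using x0(2)[of "x o\<^sub>L conjugate y k"] that y near[OF that(1,3)] by (auto simp: d_def)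
    then show "0 \<le> R x k * sin (- d x k)"
      using R_pos[OF that(1,3)] by (intro mult_nonneg_nonneg sin_ge_zero) auto
  qed
  have neg_mean: "K.mean (\<lambda>k. R x k * sin (- d x k)) = - Im \<mu>" if "x \<in> G" for x
    using K.mean_mult_right[OF cont_sin[OF that], of "- 1"] Im_mean[OF that] by simp
  have cont_neg: "continuous_on G (\<lambda>k. R x k * sin (- d x k))" if "x \<in> G" for x
    using continuous_on_minus[OF cont_sin[OF that]] by simp
  show Im0: "Im \<mu> = 0"
  proof -
    have "K.mean (\<lambda>k. 0) \<le> K.mean (\<lambda>k. R x0 k * sin (- d x0 k))"
      using nonneg x0 by (intro K.mean_mono cont_neg continuous_on_const) auto
    then show ?thesis using neg_mean[OF x0(1)] \<open>0 \<le> Im \<mu>\<close> by simp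
  qed
  (* The mean of a nonnegative function vanishes, so the maximum set of b is preserved by
     translation with the conjugates of y. *)
  have d0: "d x k = 0" if x: "x \<in> G" "b x = b x0" and k: "k \<in> G" for x k
  proof -
    have "R x k * sin (- d x k) = 0"
      using nonneg[OF x] neg_mean[OF x(1)] Im0 k by (intro K.mean_eq_0[OF cont_neg[OF x(1)]]) auto
    then have "sin (- d x k) = 0" using R_pos[OF x(1) k] by simp
    then show ?thesis using d_range[OF x k] sin_gt_zero[of "- d x k"] by force
  qed
  (* On the maximum set of b the quotients f (x s) / f x are positive. Where |f| is minimal on this
     set, none of them is less than 1, and neither is their mean. *)
  let ?M = "{x \<in> G. b x = b x0}"
  have "closed ?M" using compact_imp_closed[OF compact_G]
    by (intro continuous_closed_preimage_constant b)
  then have "compact ?M"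
    using compact_Int_closed[OF compact_G, of ?M] by (simp add: Int_def)
  moreover have "?M \<noteq> {}" using x0 by blast
  moreover have "continuous_on ?M (\<lambda>x. cmod (f x))"
    by (intro continuous_intros continuous_on_subset[OF cont_f]) auto
  ultimately obtain x where x: "x \<in> G" "b x = b x0"
    and min: "\<And>x'. x' \<in> G \<Longrightarrow> b x' = b x0 \<Longrightarrow> cmod (f x) \<le> cmod (f x')"
    using continuous_attains_inf[of ?M "\<lambda>x. cmod (f x)"] by blast
  have "1 \<le> R x k * cos (d x k)" if k: "k \<in> G" for k
  proof -
    have "b (x o\<^sub>L conjugate y k) = b x0" using d0[OF x k] x by (simp add: d_def)
    then have "cmod (f x) \<le> cmod (f (x o\<^sub>L conjugate y k))" using x y k by (intro min) auto
    then show ?thesis using d0[OF x k] nz[OF x(1)] by (simp add: R_def f_def)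
  qed
  then have "K.mean (\<lambda>k. 1) \<le> K.mean (\<lambda>k. R x k * cos (d x k))"
    by (intro K.mean_mono cont_cos x continuous_on_const)
  then show "Re \<mu> \<ge> 1" using Re_mean[OF x(1)] by simp
qed

text \<open>
  The phase \<open>b\<close> is uniformly continuous and conjugation by the bounded group \<open>G\<close> expands distances by at most a
  constant factor, so all conjugates of a sufficiently small commutator \<open>y\<close> change \<open>b\<close> by less than \<open>\<pi>\<close>.
\<close>

theorem orbit_functional_has_zero:
  fixes l :: "'v \<Rightarrow> complex"
  assumes conn: "connected G" and irr: "irreducible_on smul G"
    and dim: "dim (UNIV :: 'v set) > 1"
    and l: "Vector_Spaces.linear smul (*) l"
  shows "\<exists>g\<in>G. l (g v) = 0"
proof (rule ccontr)
  assume "\<not> ?thesis"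
  then have nz: "\<And>g. g \<in> G \<Longrightarrow> l (g v) \<noteq> 0" by blast
  interpret l: Vector_Spaces.linear smul "(*)" l by (rule l)
  have v: "v \<noteq> 0" using nz[OF id_in] by auto
  have lin_l: "linear l" by (rule real_linear_functional[OF l])
  have cont_f: "continuous_on G (\<lambda>x. l (x v))"
    by (intro continuous_on_linear_image[OF _ lin_l] continuous_intros)
  obtain u b where u: "\<And>x y. x \<in> G \<Longrightarrow> y \<in> G \<Longrightarrow> u (x o\<^sub>L y) = u x * u y"
      "\<And>x. x \<in> G \<Longrightarrow> cmod (u x) = 1"
    and b: "continuous_on G b"
    and phase: "\<And>x. x \<in> G \<Longrightarrow>
      l (x v) = of_real (cmod (l (x v))) * sgn (l (id_blinfun v)) * u x * cis (b x)"
    using K.phase_factorization[OF conn cont_f nz] by blast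
  obtain \<delta> where \<delta>: "\<delta> > 0"
    "\<And>x s. x \<in> G \<Longrightarrow> s \<in> G \<Longrightarrow> dist s id_blinfun < \<delta> \<Longrightarrow> dist (b (x o\<^sub>L s)) (b x) < pi"
    using K.uniformly_continuous_right[OF b pi_gt_zero] by blast
  obtain C where C: "C > 0" "\<And>g. g \<in> G \<Longrightarrow> norm g \<le> C" using bounded_G by blast
  obtain a c where ac: "a \<in> G" "c \<in> G" "a o\<^sub>L c \<noteq> c o\<^sub>L a"
    using abelian_dim_le_1[OF irr _ v] dim by force
  have "\<delta> / (C * C) > 0" using \<delta> C by simp
  from small_commutator[OF conn ac this] obtain c' where c': "c' \<in> G"
    "a o\<^sub>L c' o\<^sub>L iv a o\<^sub>L iv c' \<noteq> id_blinfun"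
    "norm ((a o\<^sub>L c' o\<^sub>L iv a o\<^sub>L iv c') - id_blinfun) < \<delta> / (C * C)" by blast
  define y where "y = a o\<^sub>L c' o\<^sub>L iv a o\<^sub>L iv c'"
  have y: "y \<in> G" using ac c' by (simp add: y_def)
  have "u id_blinfun = 1" using u(1)[OF id_in id_in] u(2)[OF id_in] by auto
  then have "u a * u (iv a) = 1" "u c' * u (iv c') = 1"
    using u(1)[of a "iv a"] u(1)[of c' "iv c'"] ac c' by simp_all
  moreover have "u y = (u a * u (iv a)) * (u c' * u (iv c'))"
    using ac c' by (simp add: y_def u(1))
  ultimately have "u y = 1" by simp
  have near: "\<bar>b (x o\<^sub>L conjugate y k) - b x\<bar> < pi" if "x \<in> G" "k \<in> G" for x k
  proof -
    have "conjugate y k - id_blinfun = k o\<^sub>L (y - id_blinfun) o\<^sub>L iv k"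
      by (rule blinfun_eqI) (simp add: conjugate_def blinfun.diff_left blinfun.diff_right that)
    then have "norm (conjugate y k - id_blinfun) \<le> norm k * norm (y - id_blinfun) * norm (iv k)"
      by (simp only: norm_blinfun_compose3)
    also have "\<dots> \<le> C * norm (y - id_blinfun) * C"
      using that C by (intro mult_mono) auto
    also have "\<dots> < \<delta>" using c'(3) C by (simp add: y_def field_simps)
    finally show ?thesis
      using \<delta>(2)[of x "conjugate y k"] that y by (simp add: dist_norm)
  qed
  obtain \<mu> where \<mu>: "\<And>w. conj_mean y w = smul \<mu> w"
    using Schur[OF irr conj_mean_linear[OF y] conj_mean_commute[OF y] linear_G v] by blast
  note \<mu>_real = conj_mean_scalar_ge_1[OF l nz u b phase y \<open>u y = 1\<close> near \<mu>]
  have "\<mu> = complex_of_real (Re \<mu>)" using \<mu>_real(1) by (simp add: complex_eq_iff)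
  then have "\<And>w. conj_mean y w = Re \<mu> *\<^sub>R w" using \<mu> smul_of_real by metis
  then have "y = id_blinfun" using \<mu>_real(2) y by (intro id_of_conj_mean_ge_1)
  then show False using c'(2) by (simp add: y_def)
qed

end

section \<open>Zeros of linear functionals on orbits\<close>

theorem corollary1:
  fixes smul :: "complex \<Rightarrow> 'v::euclidean_space \<Rightarrow> 'v"
    and G :: "('v \<Rightarrow>\<^sub>L 'v) set"
    and v :: 'v and H :: "'v set"
  assumes "complex_linear_space smul"
    and "vector_space.dim smul (UNIV :: 'v set) > 1"
    and "subgroup G (GL smul)"
    and "compact G"
    and "connected G"
    and "irreducible_on smul G"
    and "module.subspace smul H"
    and "vector_space.dim smul H + 1 = vector_space.dim smul (UNIV :: 'v set)"
  shows "\<exists>g\<in>G. blinfun_apply g v \<in> H"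
proof -
  interpret complex_linear_space smul by fact
  interpret compact_linear_group smul G
    by (intro compact_linear_group.intro compact_linear_group_axioms.intro assms)
  obtain l :: "'v \<Rightarrow> complex" where l: "Vector_Spaces.linear smul (*) l" "\<And>x. l x = 0 \<Longrightarrow> x \<in> H"
    using hyperplane_functional[OF assms(7,8)] by blast
  then show ?thesis using orbit_functional_has_zero[OF assms(5,6,2) l(1)] by blast
qed

end
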